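(* Let $k$ be $\mathbb{Z}$ or $\mathbb{R}$, let $A$ and $B$ be pm-rings equipped with $k$-algebra structures, and let $h:A\to B$ be a morphism (a unital $k$-algebra homomorphism) with kernel $I$. Suppose that $h(A)$ is fully invariant in $B$. Then there exists a natural morphism (group homomorphism) $h^{\ast}$ from $\pi_{k}^{alg}(B)$ to $\pi_{k}^{alg}(A/I)$. Moreover, if $h$ is an isomorphism, then so is $h^{\ast}$.
   Context: All rings are commutative with unity. A pm-ring is a ring in which every prime ideal is contained in a unique maximal ideal; homomorphic images of pm-rings are pm-rings. $\mathrm{Spec}(A)$ and $\mathrm{Max}(A)$, the sets of prime and maximal ideals of $A$, carry the Zariski topology. For a pm-ring $A$, let $\mu:\mathrm{Spec}(A)\to\mathrm{Max}(A)$ send each prime ideal to the unique maximal ideal containing it (this is a continuous retraction, and $\mathrm{Max}(A)$ is compact Hausdorff). For a pm-ring $A$ with a $k$-algebra structure, $E_k(A)$ is the monoid of unital $k$-algebra endomorphisms of $A$. For $f\in E_k(A)$, the induced spectral map $\mu_f:\mathrm{Max}(A)\to\mathrm{Max}(A)$ is the continuous map $\mu_f(M)=\mu(f^{-1}(M))$. Put $X_k^A=\{\mu_f : f\in E_k(A)\}$, with the subspace topology from the space $C(\mathrm{Max}(A),\mathrm{Max}(A))$ of continuous self-maps with the compact-open topology. The spectral fundamental group of $A$ is $\pi_k^{alg}(A):=\pi_1(X_k^A,\mu_{id_A})$, i.e. the group of based-homotopy classes of loops in $X_k^A$ at $\mu_{id_A}$ (the identity map of $\mathrm{Max}(A)$),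 with the operation induced by concatenation. A $k$-subalgebra $D$ of $B$ is fully invariant in $B$ if $f(D)\subseteq D$ for every $f\in E_k(B)$. *)

theory Defs
  imports
    "HOL-Analysis.Analysis"
    "HOL-Algebra.Module"
    "HOL-Algebra.QuotRing"
    "HOL-Algebra.Subrings"
begin

section \<open>Spectra and pm-rings\<close>

definition Spec :: "('a, 'm) ring_scheme \<Rightarrow> 'a set set" where
  "Spec A = {P. primeideal P A}"

definition Max_spec :: "('a, 'm) ring_scheme \<Rightarrow> 'a set set" where
  "Max_spec A = {M. maximalideal M A}"

text \<open>The closed sets are the sets \<open>V(E) = {P. E \<subseteq> P}\<close>.\<close>

definition zariski :: "('a, 'm) ring_scheme \<Rightarrow> 'a set topology" where
  "zariski A = topology (\<lambda>U. \<exists>E \<subseteq> carrier A. U = Spec A - {P. E \<subseteq> P})"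

definition max_topology :: "('a, 'm) ring_scheme \<Rightarrow> 'a set topology" where
  "max_topology A = subtopology (zariski A) (Max_spec A)"

text \<open>The zero ring is allowed, as both conditions hold for it.\<close>

definition pm_ring :: "('a, 'm) ring_scheme \<Rightarrow> bool" where
  "pm_ring A \<longleftrightarrow> cring A \<and> (\<forall>P \<in> Spec A. \<exists>!M. M \<in> Max_spec A \<and> P \<subseteq> M)"

definition retraction_mu :: "('a, 'm) ring_scheme \<Rightarrow> 'a set \<Rightarrow> 'a set" where
  "retraction_mu A P = (THE M. M \<in> Max_spec A \<and> P \<subseteq> M)"

lemma istopology_zariski:
  "istopology (\<lambda>U. \<exists>E \<subseteq> carrier A. U = Spec A - {P. E \<subseteq> P})"
proof -
  have int: "\<exists>E \<subseteq> carrier A. S \<inter> T = Spec A - {P. E \<subseteq> P}"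
    if S: "E1 \<subseteq> carrier A" "S = Spec A - {P. E1 \<subseteq> P}"
      and T: "E2 \<subseteq> carrier A" "T = Spec A - {P. E2 \<subseteq> P}" for S T E1 E2
  proof (cases "cring A")
    case False
    then have "Spec A = {}"
      by (auto simp: Spec_def primeideal_def)
    then show ?thesis
      using S T by auto
  next
    case True
    then interpret cring A .
    let ?E = "(\<lambda>(x, y). x \<otimes>\<^bsub>A\<^esub> y) ` (E1 \<times> E2)"
    have sub: "?E \<subseteq> carrier A"
      using S(1) T(1) by auto
    have "(?E \<subseteq> P) = (E1 \<subseteq> P \<or> E2 \<subseteq> P)" if P: "P \<in> Spec A" for P
    proof -
      interpret P: primeideal P A
        using P by (simp add: Spec_def)
      show ?thesis
      proof
        assume E: "?E \<subseteq> P"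
        show "E1 \<subseteq> P \<or> E2 \<subseteq> P"
        proof (rule ccontr)
          assume "\<not> (E1 \<subseteq> P \<or> E2 \<subseteq> P)"
          then obtain x y where xy: "x \<in> E1" "x \<notin> P" "y \<in> E2" "y \<notin> P"
            by blast
          then have "x \<otimes>\<^bsub>A\<^esub> y \<in> P"
            using E by (metis (no_types, lifting) SigmaI case_prod_conv image_subset_iff)
          then show False
            using P.I_prime[of x y] xy S(1) T(1) by blast
        qed
      next
        assume "E1 \<subseteq> P \<or> E2 \<subseteq> P"
        then have "x \<otimes>\<^bsub>A\<^esub> y \<in> P" if "x \<in> E1" "y \<in> E2" for x y
          using that S(1) T(1) P.I_l_closed[of y x] P.I_r_closed[of x y] by blast
        then show "?E \<subseteq> P"
          by (simp add: image_subset_iff)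
      qed
    qed
    then have "S \<inter> T = Spec A - {P. ?E \<subseteq> P}"
      unfolding S(2) T(2) by blast
    with sub show ?thesis by blast
  qed
  have un: "\<exists>E \<subseteq> carrier A. \<Union>\<K> = Spec A - {P. E \<subseteq> P}"
    if K: "\<forall>U\<in>\<K>. \<exists>E \<subseteq> carrier A. U = Spec A - {P. E \<subseteq> P}" for \<K>
  proof -
    obtain e where e: "\<And>U. U \<in> \<K> \<Longrightarrow> e U \<subseteq> carrier A \<and> U = Spec A - {P. e U \<subseteq> P}"
      using K by metis
    have "\<Union>\<K> = Spec A - {P. \<Union>(e ` \<K>) \<subseteq> P}"
      using e by blast
    moreover have "\<Union>(e ` \<K>) \<subseteq> carrier A"
      using e by blast
    ultimately show ?thesis by blast
  qed
  show ?thesis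
    unfolding istopology_def
  proof (intro conjI allI impI)
    fix S T
    assume "\<exists>E \<subseteq> carrier A. S = Spec A - {P. E \<subseteq> P}" "\<exists>E \<subseteq> carrier A. T = Spec A - {P. E \<subseteq> P}"
    then show "\<exists>E \<subseteq> carrier A. S \<inter> T = Spec A - {P. E \<subseteq> P}"
      using int by meson
  next
    fix \<K>
    assume "\<forall>U\<in>\<K>. \<exists>E \<subseteq> carrier A. U = Spec A - {P. E \<subseteq> P}"
    then show "\<exists>E \<subseteq> carrier A. \<Union>\<K> = Spec A - {P. E \<subseteq> P}"
      by (rule un)
  qed
qed

lemma openin_zariski:
  "openin (zariski A) U \<longleftrightarrow> (\<exists>E \<subseteq> carrier A. U = Spec A - {P. E \<subseteq> P})"
  unfolding zariski_def by (subst topology_inverse'[OF istopology_zariski]) (rule refl)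

section \<open>Algebras over a subring of the reals\<close>

definition real_subring :: "real set \<Rightarrow> real ring" where
  "real_subring S = \<lparr>carrier = S, mult = (*), one = 1, zero = 0, add = (+)\<rparr>"

definition alg_hom ::
  "('k, 'l) ring_scheme \<Rightarrow> ('k, 'a, 'm) module_scheme \<Rightarrow> ('k, 'b, 'n) module_scheme \<Rightarrow> ('a \<Rightarrow> 'b) set"
  where
  "alg_hom K A B =
     {h \<in> ring_hom A B. \<forall>r \<in> carrier K. \<forall>x \<in> carrier A. h (r \<odot>\<^bsub>A\<^esub> x) = r \<odot>\<^bsub>B\<^esub> h x}"

definition alg_iso ::
  "('k, 'l) ring_scheme \<Rightarrow> ('k, 'a, 'm) module_scheme \<Rightarrow> ('k, 'b, 'n) module_scheme \<Rightarrow> ('a \<Rightarrow> 'b) set"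
  where
  "alg_iso K A B = {h \<in> alg_hom K A B. bij_betw h (carrier A) (carrier B)}"

abbreviation alg_endo ::
  "('k, 'l) ring_scheme \<Rightarrow> ('k, 'a, 'm) module_scheme \<Rightarrow> ('a \<Rightarrow> 'a) set" where
  "alg_endo K A \<equiv> alg_hom K A A"

definition fully_invariant ::
  "('k, 'l) ring_scheme \<Rightarrow> ('k, 'b, 'n) module_scheme \<Rightarrow> 'b set \<Rightarrow> bool" where
  "fully_invariant K B D \<longleftrightarrow>
     subcring D B \<and> (\<forall>r \<in> carrier K. \<forall>x \<in> D. r \<odot>\<^bsub>B\<^esub> x \<in> D) \<and>
     (\<forall>f \<in> alg_endo K B. f ` D \<subseteq> D)"

text \<open>The scalar multiplication is \<open>r (I + a) = I + r a\<close>, in the style of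
  \<^const>\<open>rcoset_mult\<close>; see \<open>quot_algebra_smult\<close> below.\<close>

definition quot_algebra :: "('k, 'a, 'm) module_scheme \<Rightarrow> 'a set \<Rightarrow> ('k, 'a set) module" where
  "quot_algebra A I =
     \<lparr>carrier = carrier (A Quot I), mult = mult (A Quot I), one = one (A Quot I),
      zero = zero (A Quot I), add = add (A Quot I),
      smult = (\<lambda>r X. \<Union>x\<in>X. I +>\<^bsub>A\<^esub> (r \<odot>\<^bsub>A\<^esub> x))\<rparr>"

lemma quot_algebra_smult:
  assumes "algebra K A" "ideal I A" "r \<in> carrier K" "a \<in> carrier A"
  shows "r \<odot>\<^bsub>quot_algebra A I\<^esub> (I +>\<^bsub>A\<^esub> a) = I +>\<^bsub>A\<^esub> (r \<odot>\<^bsub>A\<^esub> a)"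
proof -
  interpret algebra K A by fact
  interpret I: ideal I A by fact
  have eq: "I +>\<^bsub>A\<^esub> (r \<odot>\<^bsub>A\<^esub> x) = I +>\<^bsub>A\<^esub> (r \<odot>\<^bsub>A\<^esub> a)" if x: "x \<in> I +>\<^bsub>A\<^esub> a" for x
  proof -
    obtain i where i: "i \<in> I" "x = i \<oplus>\<^bsub>A\<^esub> a"
      using x by (auto simp: a_r_coset_def')
    have ic: "i \<in> carrier A"
      using i I.Icarr by blast
    have "r \<odot>\<^bsub>A\<^esub> i = (r \<odot>\<^bsub>A\<^esub> \<one>\<^bsub>A\<^esub>) \<otimes>\<^bsub>A\<^esub> i"
      using smult_assoc2[of r "\<one>\<^bsub>A\<^esub>" i] ic assms(3) by simp
    then have "r \<odot>\<^bsub>A\<^esub> i \<in> I"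
      using I.I_l_closed[OF i(1), of "r \<odot>\<^bsub>A\<^esub> \<one>\<^bsub>A\<^esub>"] assms(3) by simp
    moreover have "r \<odot>\<^bsub>A\<^esub> x = r \<odot>\<^bsub>A\<^esub> i \<oplus>\<^bsub>A\<^esub> r \<odot>\<^bsub>A\<^esub> a"
      using i ic assms(3,4) by (simp add: smult_r_distr)
    ultimately have "r \<odot>\<^bsub>A\<^esub> x \<in> I +>\<^bsub>A\<^esub> (r \<odot>\<^bsub>A\<^esub> a)"
      by (auto simp: a_r_coset_def')
    then show ?thesis
      using abelian_group.a_repr_independence[OF M.abelian_group_axioms _ _ I.a_subgroup] assms(3,4)
      by (metis smult_closed)
  qed
  have "a \<in> I +>\<^bsub>A\<^esub> a"
    using I.a_rcos_self assms(4) by blast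
  with eq have "(\<Union>x \<in> I +>\<^bsub>A\<^esub> a. I +>\<^bsub>A\<^esub> (r \<odot>\<^bsub>A\<^esub> x)) = I +>\<^bsub>A\<^esub> (r \<odot>\<^bsub>A\<^esub> a)"
    by blast
  then show ?thesis
    by (simp add: quot_algebra_def)
qed

text \<open>The map that \<open>h : A \<rightarrow> B\<close> induces on cosets of its kernel, \<open>I + a \<mapsto> h a\<close>
  (\<open>h\<close> is constant on every coset).\<close>

definition factor_map :: "('a \<Rightarrow> 'b) \<Rightarrow> 'a set \<Rightarrow> 'b" where
  "factor_map h X = the_elem (h ` X)"

section \<open>Mapping spaces and fundamental groups\<close>

text \<open>Continuous maps are represented by functions that are \<^const>\<open>undefined\<close> outside the
  space, so that equality of maps is equality of functions.\<close>

definition cts_maps :: "'a topology \<Rightarrow> 'b topology \<Rightarrow> ('a \<Rightarrow> 'b) set" where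
  "cts_maps X Y = {f \<in> extensional (topspace X). continuous_map X Y f}"

definition compact_open_topology :: "'a topology \<Rightarrow> 'b topology \<Rightarrow> ('a \<Rightarrow> 'b) topology" where
  "compact_open_topology X Y =
     topology_generated_by {{f \<in> cts_maps X Y. f ` C \<subseteq> U} | C U. compactin X C \<and> openin Y U}"

definition loops :: "'a topology \<Rightarrow> 'a \<Rightarrow> (real \<Rightarrow> 'a) set" where
  "loops X x = {p. pathin X p \<and> p 0 = x \<and> p 1 = x}"

definition loop_homotopic :: "'a topology \<Rightarrow> 'a \<Rightarrow> ((real \<Rightarrow> 'a) \<times> (real \<Rightarrow> 'a)) set" where
  "loop_homotopic X x =
     {(p, q). p \<in> loops X x \<and> q \<in> loops X x \<and>
        homotopic_with (\<lambda>r. r 0 = x \<and> r 1 = x) (top_of_set {0..1}) X p q}"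

definition loop_class :: "'a topology \<Rightarrow> 'a \<Rightarrow> (real \<Rightarrow> 'a) \<Rightarrow> (real \<Rightarrow> 'a) set" where
  "loop_class X x p = loop_homotopic X x `` {p}"

text \<open>Same formula as \<^const>\<open>joinpaths\<close>, which is restricted to the class
  \<^class>\<open>topological_space\<close>.\<close>

definition concat_paths :: "(real \<Rightarrow> 'a) \<Rightarrow> (real \<Rightarrow> 'a) \<Rightarrow> real \<Rightarrow> 'a" where
  "concat_paths p q = (\<lambda>t. if t \<le> 1/2 then p (2 * t) else q (2 * t - 1))"

definition fundamental_group :: "'a topology \<Rightarrow> 'a \<Rightarrow> (real \<Rightarrow> 'a) set monoid" where
  "fundamental_group X x =
     \<lparr>carrier = loops X x // loop_homotopic X x,
      mult = (\<lambda>P Q. \<Union>p\<in>P. \<Union>q\<in>Q. loop_class X x (concat_paths p q)),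
      one = loop_class X x (\<lambda>_. x)\<rparr>"

section \<open>The spectral fundamental group\<close>

definition spectral_map :: "('a, 'm) ring_scheme \<Rightarrow> ('a \<Rightarrow> 'a) \<Rightarrow> 'a set \<Rightarrow> 'a set" where
  "spectral_map A f = (\<lambda>M \<in> Max_spec A. retraction_mu A {x \<in> carrier A. f x \<in> M})"

definition spectral_space ::
  "('k, 'l) ring_scheme \<Rightarrow> ('k, 'a, 'm) module_scheme \<Rightarrow> ('a set \<Rightarrow> 'a set) topology" where
  "spectral_space K A =
     subtopology (compact_open_topology (max_topology A) (max_topology A))
       (spectral_map A ` alg_endo K A)"

definition pi_alg ::
  "('k, 'l) ring_scheme \<Rightarrow> ('k, 'a, 'm) module_scheme \<Rightarrow> (real \<Rightarrow> 'a set \<Rightarrow> 'a set) set monoid"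
  where
  "pi_alg K A = fundamental_group (spectral_space K A) (spectral_map A id)"

end

theory Submission
  imports Defs
begin

text \<open>
  Write \<open>Q = A/I\<close> and let \<open>j : Q \<rightarrow> B\<close> be the injection induced by \<open>h\<close>. Full invariance of
  \<open>h(A) = j(Q)\<close> says that every endomorphism \<open>f\<close> of \<open>B\<close> restricts to an endomorphism \<open>g\<close>
  of \<open>Q\<close>, so that \<open>j g = f j\<close>. The candidate map on spectral spaces is \<open>\<mu>\<^sub>f \<mapsto> \<mu>\<^sub>g\<close>; the point is that
  \<open>\<mu>\<^sub>g\<close> depends only on \<open>\<mu>\<^sub>f\<close>, and continuously so.

  Any homomorphism \<open>u : C \<rightarrow> D\<close> from a pm-ring induces a continuous map
  \<open>Max(D) \<rightarrow> Max(C)\<close>, \<open>N \<mapsto> \<mu>(u\<^sup>-\<^sup>1(N))\<close>, and this is functorial in \<open>u\<close>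
  (\<open>continuous_induced_max_map\<close>, \<open>induced_max_map_comp\<close>). Let \<open>p : Max(B) \<rightarrow> Max(Q)\<close> be the map induced
  by \<open>j\<close>. Functoriality turns \<open>j g = f j\<close> into \<open>\<mu>\<^sub>g \<circ> p = p \<circ> \<mu>\<^sub>f\<close>. Because \<open>j\<close> is injective, \<open>p\<close> is
  surjective (\<open>induced_max_map_surj\<close>), so \<open>\<mu>\<^sub>g\<close> is the map that \<open>\<mu>\<^sub>f\<close> descends to along \<open>p\<close>. Descending along
  a continuous surjection from a compact space onto a Hausdorff space is continuous for the
  compact-open topologies (\<open>continuous_map_descend\<close>): \<open>\<mu>\<^sub>g\<close> maps \<open>C\<close> into \<open>U\<close> iff \<open>\<mu>\<^sub>f\<close> maps \<open>p\<^sup>-\<^sup>1(C)\<close> into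
  \<open>p\<^sup>-\<^sup>1(U)\<close>, and \<open>p\<^sup>-\<^sup>1(C)\<close> is again compact. The group homomorphism is the image of this continuous
  map under the fundamental group functor. If \<open>h\<close> is an isomorphism, then the same construction for
  \<open>j\<^sup>-\<^sup>1\<close> gives the inverse map of spectral spaces, and functoriality gives an isomorphism of groups.

  The topological facts about pm-rings (the Hausdorff property, continuity of \<open>\<mu>\<close>, stability under
  quotients) all come from one elementwise form of the pm-condition, \<open>comaximal_splitting\<close>:
  whenever \<open>a + b = 1\<close>, there are \<open>x \<in> 1 + (a)\<close> and \<open>y \<in> 1 + (b)\<close> with \<open>x y = 0\<close>.
\<close>

section \<open>Prime and maximal ideals avoiding a multiplicative set\<close>

lemma (in ring) ideal_Union_directed:
  assumes ne: "\<F> \<noteq> {}" and id: "\<And>I. I \<in> \<F> \<Longrightarrow> ideal I R"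
    and dir: "\<And>I J. I \<in> \<F> \<Longrightarrow> J \<in> \<F> \<Longrightarrow> \<exists>L\<in>\<F>. I \<union> J \<subseteq> L"
  shows "ideal (\<Union>\<F>) R"
proof (rule idealI[OF ring_axioms])
  note sub = additive_subgroup.a_subset[OF ideal.axioms(1)[OF id]]
  show "subgroup (\<Union>\<F>) (add_monoid R)"
  proof (rule add.subgroupI)
    show "\<Union>\<F> \<subseteq> carrier R" using sub by blast
    show "\<Union>\<F> \<noteq> {}"
      using ne id additive_subgroup.zero_closed ideal.axioms(1) by fastforce
    show "\<ominus> a \<in> \<Union>\<F>" if "a \<in> \<Union>\<F>" for a
      using that id by (meson UnionE UnionI additive_subgroup.a_inv_closed ideal.axioms(1))
    show "a \<oplus> b \<in> \<Union>\<F>" if ab: "a \<in> \<Union>\<F>" "b \<in> \<Union>\<F>" for a b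
    proof -
      obtain I J where "I \<in> \<F>" "J \<in> \<F>" "a \<in> I" "b \<in> J" using ab by blast
      moreover then obtain L where "L \<in> \<F>" "I \<union> J \<subseteq> L" using dir by blast
      ultimately have "a \<in> L" "b \<in> L" "L \<in> \<F>" by auto
      then show ?thesis
        using additive_subgroup.a_closed[OF ideal.axioms(1)[OF id]] by blast
    qed
  qed
  show "x \<otimes> a \<in> \<Union>\<F>" if "a \<in> \<Union>\<F>" "x \<in> carrier R" for a x
    using that ideal.I_l_closed[OF id] by blast
  show "a \<otimes> x \<in> \<Union>\<F>" if "a \<in> \<Union>\<F>" "x \<in> carrier R" for a x
    using that ideal.I_r_closed[OF id] by blast
qed

lemma (in ring) exists_ideal_maximal_avoiding:
  assumes J: "ideal J R" "J \<inter> S = {}"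
  obtains P where "ideal P R" "J \<subseteq> P" "P \<inter> S = {}"
    and "\<And>P'. ideal P' R \<Longrightarrow> P \<subseteq> P' \<Longrightarrow> P' \<inter> S = {} \<Longrightarrow> P' = P"
proof -
  define \<A> where "\<A> = {P. ideal P R \<and> J \<subseteq> P \<and> P \<inter> S = {}}"
  have "\<exists>M\<in>\<A>. \<forall>X\<in>\<A>. M \<subseteq> X \<longrightarrow> X = M"
  proof (rule subset_Zorn_nonempty)
    show "\<A> \<noteq> {}" using J by (auto simp: \<A>_def)
    fix \<C> assume ne: "\<C> \<noteq> {}" and ch: "subset.chain \<A> \<C>"
    have sub: "\<C> \<subseteq> \<A>" and tot: "\<And>X Y. X \<in> \<C> \<Longrightarrow> Y \<in> \<C> \<Longrightarrow> X \<subseteq> Y \<or> Y \<subseteq> X"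
      using ch by (auto simp: subset_chain_def)
    have "ideal (\<Union>\<C>) R"
    proof (rule ideal_Union_directed[OF ne])
      show "ideal X R" if "X \<in> \<C>" for X using that sub by (auto simp: \<A>_def)
      show "\<exists>L\<in>\<C>. X \<union> Y \<subseteq> L" if "X \<in> \<C>" "Y \<in> \<C>" for X Y
        using tot[OF that] that by (metis Un_absorb1 Un_absorb2 order_refl)
    qed
    then show "\<Union>\<C> \<in> \<A>" using ne sub by (auto simp: \<A>_def)
  qed
  then obtain M where "M \<in> \<A>" "\<And>X. X \<in> \<A> \<Longrightarrow> M \<subseteq> X \<Longrightarrow> X = M" by blast
  then show thesis by (intro that[of M]) (auto simp: \<A>_def)
qed

text \<open>The ideal \<open>P + (a)\<close>, given abstractly by the only properties that matter below: it
  enlarges \<open>P\<close> by \<open>a\<close>, and its elements have the form \<open>p + r a\<close>.\<close>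

lemma (in cring) ideal_add_principal:
  assumes P: "ideal P R" and a: "a \<in> carrier R"
  obtains J where "ideal J R" "P \<subseteq> J" "a \<in> J"
    and "\<And>x. x \<in> J \<Longrightarrow> \<exists>p\<in>P. \<exists>r\<in>carrier R. x = p \<oplus> r \<otimes> a"
proof (rule that[of "set_add R P (PIdl a)"])
  interpret P: ideal P R by fact
  have mem: "p \<oplus> r \<otimes> a \<in> set_add R P (PIdl a)" if "p \<in> P" "r \<in> carrier R" for p r
    using that by (auto simp: set_add_defs cgenideal_def)
  show "ideal (set_add R P (PIdl a)) R" by (rule add_ideals[OF P cgenideal_ideal[OF a]])
  show "P \<subseteq> set_add R P (PIdl a)"
    using mem[OF _ zero_closed] a P.Icarr by fastforce
  show "a \<in> set_add R P (PIdl a)"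
    using mem[OF P.zero_closed one_closed] a by simp
  show "\<exists>p\<in>P. \<exists>r\<in>carrier R. x = p \<oplus> r \<otimes> a" if "x \<in> set_add R P (PIdl a)" for x
    using that by (auto simp: set_add_defs cgenideal_def)
qed

text \<open>Krull's lemma. An ideal \<open>P\<close> that is maximal among those avoiding \<open>S\<close> is prime: if \<open>a\<close> and \<open>b\<close> lie
  outside \<open>P\<close>, then \<open>P + (a)\<close> and \<open>P + (b)\<close> meet \<open>S\<close>, and the product of the two elements
  found is in \<open>S\<close>, so it is not in \<open>P\<close>, which excludes \<open>a b \<in> P\<close>.\<close>

lemma (in cring) exists_primeideal_avoiding:
  assumes J: "ideal J R" "J \<inter> S = {}" and one: "\<one> \<in> S"
    and mult: "\<And>x y. x \<in> S \<Longrightarrow> y \<in> S \<Longrightarrow> x \<otimes> y \<in> S"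
  obtains P where "primeideal P R" "J \<subseteq> P" "P \<inter> S = {}"
proof -
  obtain P where P: "ideal P R" "J \<subseteq> P" "P \<inter> S = {}"
    and mx: "\<And>P'. ideal P' R \<Longrightarrow> P \<subseteq> P' \<Longrightarrow> P' \<inter> S = {} \<Longrightarrow> P' = P"
    using exists_ideal_maximal_avoiding[OF J] by blast
  interpret P: ideal P R by fact
  have meet: "\<exists>p\<in>P. \<exists>r\<in>carrier R. p \<oplus> r \<otimes> a \<in> S" if a: "a \<in> carrier R" "a \<notin> P" for a
  proof -
    obtain J' where J': "ideal J' R" "P \<subseteq> J'" "a \<in> J'"
      and J'_mem: "\<And>x. x \<in> J' \<Longrightarrow> \<exists>p\<in>P. \<exists>r\<in>carrier R. x = p \<oplus> r \<otimes> a"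
      using ideal_add_principal[OF P(1) a(1)] by blast
    have "J' \<inter> S \<noteq> {}" using mx[OF J'(1,2)] J'(3) a(2) by blast
    then show ?thesis using J'_mem by blast
  qed
  have "primeideal P R"
  proof (rule primeidealI[OF P(1) is_cring])
    show "carrier R \<noteq> P" using one P(3) one_closed by blast
    fix a b assume ab: "a \<in> carrier R" "b \<in> carrier R" "a \<otimes> b \<in> P"
    show "a \<in> P \<or> b \<in> P"
    proof (rule ccontr)
      assume "\<not> (a \<in> P \<or> b \<in> P)"
      then obtain p r q t where
        p: "p \<in> P" "r \<in> carrier R" "p \<oplus> r \<otimes> a \<in> S"
        and q: "q \<in> P" "t \<in> carrier R" "q \<oplus> t \<otimes> b \<in> S"
        using meet ab(1,2) by metis
      have c: "p \<in> carrier R" "q \<in> carrier R" using p q P.Icarr by auto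
      have "(p \<oplus> r \<otimes> a) \<otimes> (q \<oplus> t \<otimes> b) = p \<otimes> (q \<oplus> t \<otimes> b) \<oplus> ((r \<otimes> a) \<otimes> q \<oplus> (r \<otimes> t) \<otimes> (a \<otimes> b))"
        using c p(2) q(2) ab(1,2) by (simp add: l_distr r_distr m_ac a_ac)
      moreover have "\<dots> \<in> P"
        using c p q ab by (intro P.a_closed) (auto intro: P.I_l_closed P.I_r_closed)
      ultimately show False using mult[OF p(3) q(3)] P(3) by auto
    qed
  qed
  with P show thesis using that by blast
qed

text \<open>Avoiding \<open>S = {1}\<close> means being proper.\<close>

lemma (in cring) exists_maximalideal:
  assumes J: "ideal J R" "J \<noteq> carrier R"
  obtains M where "maximalideal M R" "J \<subseteq> M"
proof -
  have one: "\<one> \<notin> L \<longleftrightarrow> L \<noteq> carrier R" if "ideal L R" for L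
    using that ideal.one_imp_carrier one_closed by blast
  obtain P where P: "ideal P R" "J \<subseteq> P" "P \<inter> {\<one>} = {}"
    and mx: "\<And>P'. ideal P' R \<Longrightarrow> P \<subseteq> P' \<Longrightarrow> P' \<inter> {\<one>} = {} \<Longrightarrow> P' = P"
    using exists_ideal_maximal_avoiding[OF J(1), of "{\<one>}"] one[OF J(1)] J(2) by blast
  have "maximalideal P R"
    by (rule maximalidealI[OF P(1)]) (use P mx one in blast)+
  with P(2) that show thesis by blast
qed

lemma (in cring) maximalideal_comaximal:
  assumes M: "maximalideal M R" and e: "e \<in> carrier R" "e \<notin> M"
  obtains m c where "m \<in> M" "c \<in> carrier R" "m \<oplus> c \<otimes> e = \<one>"
proof -
  interpret M: maximalideal M R by fact
  obtain J where J: "ideal J R" "M \<subseteq> J" "e \<in> J"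
    and J_mem: "\<And>x. x \<in> J \<Longrightarrow> \<exists>p\<in>M. \<exists>r\<in>carrier R. x = p \<oplus> r \<otimes> e"
    using ideal_add_principal[OF M.is_ideal e(1)] by blast
  have "J = carrier R"
    using M.I_maximal[OF J(1,2)] J(3) e(2) additive_subgroup.a_subset[OF ideal.axioms(1)[OF J(1)]]
    by blast
  then obtain p r where "p \<in> M" "r \<in> carrier R" "\<one> = p \<oplus> r \<otimes> e"
    using J_mem one_closed by blast
  then show thesis using that[of p r] by simp
qed

section \<open>The elementwise form of the pm-condition\<close>

text \<open>For a proper ideal, \<open>x + r a = 1\<close> forbids \<open>x\<close> and \<open>a\<close> to be both members; both directions of
  this exclusion are used to move between the factors of a splitting and maximal ideals.\<close>

lemma (in ideal) not_mem_if_comaximal: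
  assumes "I \<noteq> carrier R" "a \<in> I" "r \<in> carrier R" "x \<oplus> r \<otimes> a = \<one>"
  shows "x \<notin> I"
proof
  assume "x \<in> I"
  then have "x \<oplus> r \<otimes> a \<in> I"
    using additive_subgroup.a_closed[OF is_additive_subgroup] I_l_closed assms(2,3) by blast
  then show False using assms(1,4) one_imp_carrier by simp
qed

text \<open>The characterization of pm-rings by \<open>(1 - r a) (1 - s b) = 0\<close> for suitable \<open>r\<close>, \<open>s\<close>. It is stated
  without subtraction, in a form that ring homomorphisms visibly preserve.\<close>

definition comaximal_splitting :: "('a, 'm) ring_scheme \<Rightarrow> bool" where
  "comaximal_splitting A \<longleftrightarrow>
     (\<forall>a \<in> carrier A. \<forall>b \<in> carrier A. a \<oplus>\<^bsub>A\<^esub> b = \<one>\<^bsub>A\<^esub> \<longrightarrow>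
        (\<exists>x \<in> carrier A. \<exists>y \<in> carrier A. \<exists>r \<in> carrier A. \<exists>s \<in> carrier A.
           x \<oplus>\<^bsub>A\<^esub> r \<otimes>\<^bsub>A\<^esub> a = \<one>\<^bsub>A\<^esub> \<and> y \<oplus>\<^bsub>A\<^esub> s \<otimes>\<^bsub>A\<^esub> b = \<one>\<^bsub>A\<^esub> \<and> x \<otimes>\<^bsub>A\<^esub> y = \<zero>\<^bsub>A\<^esub>))"

lemma comaximal_splittingE:
  assumes "comaximal_splitting A" "a \<in> carrier A" "b \<in> carrier A" "a \<oplus>\<^bsub>A\<^esub> b = \<one>\<^bsub>A\<^esub>"
  obtains x y r s where "x \<in> carrier A" "y \<in> carrier A" "r \<in> carrier A" "s \<in> carrier A"
    "x \<oplus>\<^bsub>A\<^esub> r \<otimes>\<^bsub>A\<^esub> a = \<one>\<^bsub>A\<^esub>" "y \<oplus>\<^bsub>A\<^esub> s \<otimes>\<^bsub>A\<^esub> b = \<one>\<^bsub>A\<^esub>" "x \<otimes>\<^bsub>A\<^esub> y = \<zero>\<^bsub>A\<^esub>"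
  using assms(1)[unfolded comaximal_splitting_def, rule_format, OF assms(2-4)] by blast

text \<open>The products \<open>x y\<close> with \<open>x \<in> 1 + (a)\<close> and \<open>y \<in> 1 + (b)\<close> form a multiplicative set \<open>S\<close>. If \<open>0\<close> were
  not in it, some prime \<open>P\<close> would avoid it. Then \<open>P + (a)\<close> and \<open>P + (b)\<close> are proper, since
  \<open>p + r a = 1\<close> puts \<open>p\<close> into \<open>S\<close>. They lie in maximal ideals above \<open>P\<close>, which differ because no
  proper ideal contains both \<open>a\<close> and \<open>b\<close>; this contradicts the pm-condition.\<close>

lemma pm_ring_imp_comaximal_splitting:
  assumes pm: "pm_ring A"
  shows "comaximal_splitting A"
  unfolding comaximal_splitting_def
proof (intro ballI impI)
  interpret cring A using pm by (simp add: pm_ring_def)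
  fix a b assume ab: "a \<in> carrier A" "b \<in> carrier A" "a \<oplus>\<^bsub>A\<^esub> b = \<one>\<^bsub>A\<^esub>"
  \<comment> \<open>\<open>T c\<close> is the multiplicative set \<open>1 + (c)\<close>.\<close>
  define T where "T c = {x \<in> carrier A. \<exists>r \<in> carrier A. x \<oplus>\<^bsub>A\<^esub> r \<otimes>\<^bsub>A\<^esub> c = \<one>\<^bsub>A\<^esub>}" for c
  have T1: "\<one>\<^bsub>A\<^esub> \<in> T c" if c: "c \<in> carrier A" for c
  proof -
    have "\<one>\<^bsub>A\<^esub> \<oplus>\<^bsub>A\<^esub> \<zero>\<^bsub>A\<^esub> \<otimes>\<^bsub>A\<^esub> c = \<one>\<^bsub>A\<^esub>" using c by simp
    then show ?thesis unfolding T_def by blast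
  qed
  have Tm: "x \<otimes>\<^bsub>A\<^esub> x' \<in> T c" if x_T: "x \<in> T c" "x' \<in> T c" and c: "c \<in> carrier A" for x x' c
  proof -
    obtain r r' where x: "x \<in> carrier A" "r \<in> carrier A" "x \<oplus>\<^bsub>A\<^esub> r \<otimes>\<^bsub>A\<^esub> c = \<one>\<^bsub>A\<^esub>"
      and x': "x' \<in> carrier A" "r' \<in> carrier A" "x' \<oplus>\<^bsub>A\<^esub> r' \<otimes>\<^bsub>A\<^esub> c = \<one>\<^bsub>A\<^esub>"
      using x_T by (auto simp: T_def)
    \<comment> \<open>The coefficient comes from \<open>x x' = x (1 - r' c) = 1 - r c - x r' c\<close>.\<close>
    have "x \<otimes>\<^bsub>A\<^esub> x' \<oplus>\<^bsub>A\<^esub> (x \<otimes>\<^bsub>A\<^esub> r' \<oplus>\<^bsub>A\<^esub> r) \<otimes>\<^bsub>A\<^esub> c = x \<otimes>\<^bsub>A\<^esub> (x' \<oplus>\<^bsub>A\<^esub> r' \<otimes>\<^bsub>A\<^esub> c) \<oplus>\<^bsub>A\<^esub> r \<otimes>\<^bsub>A\<^esub> c"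
      using x(1,2) x'(1,2) c by (simp add: l_distr r_distr m_assoc a_assoc)
    also have "\<dots> = \<one>\<^bsub>A\<^esub>" using x x' by simp
    finally have "x \<otimes>\<^bsub>A\<^esub> x' \<oplus>\<^bsub>A\<^esub> (x \<otimes>\<^bsub>A\<^esub> r' \<oplus>\<^bsub>A\<^esub> r) \<otimes>\<^bsub>A\<^esub> c = \<one>\<^bsub>A\<^esub>" .
    moreover have "x \<otimes>\<^bsub>A\<^esub> x' \<in> carrier A" "x \<otimes>\<^bsub>A\<^esub> r' \<oplus>\<^bsub>A\<^esub> r \<in> carrier A" using x x' by auto
    ultimately show ?thesis unfolding T_def by blast
  qed
  define S where "S = {x \<otimes>\<^bsub>A\<^esub> y | x y. x \<in> T a \<and> y \<in> T b}"
  have "\<zero>\<^bsub>A\<^esub> \<in> S"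
  proof (rule ccontr)
    assume "\<zero>\<^bsub>A\<^esub> \<notin> S"
    then have dis: "{\<zero>\<^bsub>A\<^esub>} \<inter> S = {}" by blast
    have Tc: "T c \<subseteq> carrier A" for c by (auto simp: T_def)
    have S1: "\<one>\<^bsub>A\<^esub> \<in> S"
      unfolding S_def using T1[OF ab(1)] T1[OF ab(2)] r_one[OF one_closed] by force
    have Sm: "u \<otimes>\<^bsub>A\<^esub> v \<in> S" if uv: "u \<in> S" "v \<in> S" for u v
    proof -
      obtain x y x' y' where u: "u = x \<otimes>\<^bsub>A\<^esub> y" "x \<in> T a" "y \<in> T b"
        and v: "v = x' \<otimes>\<^bsub>A\<^esub> y'" "x' \<in> T a" "y' \<in> T b"
        using uv by (auto simp: S_def)
      have "u \<otimes>\<^bsub>A\<^esub> v = (x \<otimes>\<^bsub>A\<^esub> x') \<otimes>\<^bsub>A\<^esub> (y \<otimes>\<^bsub>A\<^esub> y')"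
        using u v Tc by (simp add: m_ac subset_iff)
      then show ?thesis
        unfolding S_def using Tm[OF u(2) v(2) ab(1)] Tm[OF u(3) v(3) ab(2)] by blast
    qed
    obtain P where P: "primeideal P A" "P \<inter> S = {}"
      by (rule exists_primeideal_avoiding[OF zeroideal dis S1]) (auto intro: Sm)
    interpret P: primeideal P A by fact
    have above: "\<exists>M. maximalideal M A \<and> P \<subseteq> M \<and> c \<in> M"
      if c: "c \<in> carrier A" and TS: "T c \<subseteq> S" for c
    proof -
      obtain J where J: "ideal J A" "P \<subseteq> J" "c \<in> J"
        and J_mem: "\<And>x. x \<in> J \<Longrightarrow> \<exists>p\<in>P. \<exists>r\<in>carrier A. x = p \<oplus>\<^bsub>A\<^esub> r \<otimes>\<^bsub>A\<^esub> c"
        using ideal_add_principal[OF P.is_ideal c] by blast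
      have "\<one>\<^bsub>A\<^esub> \<notin> J"
      proof
        assume "\<one>\<^bsub>A\<^esub> \<in> J"
        then obtain p r where pr: "p \<in> P" "r \<in> carrier A" "\<one>\<^bsub>A\<^esub> = p \<oplus>\<^bsub>A\<^esub> r \<otimes>\<^bsub>A\<^esub> c"
          using J_mem by blast
        then have "p \<in> T c" using P.Icarr[OF pr(1)] unfolding T_def by force
        with TS P(2) pr(1) show False by blast
      qed
      then have "J \<noteq> carrier A" using one_closed by blast
      then obtain M where "maximalideal M A" "J \<subseteq> M"
        using exists_maximalideal[OF J(1)] by blast
      with J(2,3) show ?thesis by blast
    qed
    have Ta: "T a \<subseteq> S"
    proof
      fix x assume "x \<in> T a"
      moreover then have "x = x \<otimes>\<^bsub>A\<^esub> \<one>\<^bsub>A\<^esub>" by (simp add: T_def)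
      ultimately show "x \<in> S" unfolding S_def using T1[OF ab(2)] by blast
    qed
    have Tb: "T b \<subseteq> S"
    proof
      fix x assume "x \<in> T b"
      moreover then have "x = \<one>\<^bsub>A\<^esub> \<otimes>\<^bsub>A\<^esub> x" by (simp add: T_def)
      ultimately show "x \<in> S" unfolding S_def using T1[OF ab(1)] by blast
    qed
    obtain M N where M: "maximalideal M A" "P \<subseteq> M" "a \<in> M"
      and N: "maximalideal N A" "P \<subseteq> N" "b \<in> N"
      using above[OF ab(1) Ta] above[OF ab(2) Tb] by metis
    have "M = N"
      using pm P(1) M N unfolding pm_ring_def Spec_def Max_spec_def by blast
    then have "\<one>\<^bsub>A\<^esub> \<in> M"
      using M(3) N(3) ab(3) additive_subgroup.a_closed ideal.axioms(1) maximalideal.axioms(1)[OF M(1)]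
      by metis
    then show False
      using ideal.one_imp_carrier maximalideal.axioms(1) maximalideal.I_notcarr M(1) by metis
  qed
  then show "\<exists>x \<in> carrier A. \<exists>y \<in> carrier A. \<exists>r \<in> carrier A. \<exists>s \<in> carrier A.
      x \<oplus>\<^bsub>A\<^esub> r \<otimes>\<^bsub>A\<^esub> a = \<one>\<^bsub>A\<^esub> \<and> y \<oplus>\<^bsub>A\<^esub> s \<otimes>\<^bsub>A\<^esub> b = \<one>\<^bsub>A\<^esub> \<and> x \<otimes>\<^bsub>A\<^esub> y = \<zero>\<^bsub>A\<^esub>"
    unfolding S_def T_def by (smt (verit) mem_Collect_eq)
qed

lemma distinct_maximalideals_comaximal:
  assumes "cring A" and M: "maximalideal M A" and N: "maximalideal N A" and "M \<noteq> N"
  obtains a b where "a \<in> M" "b \<in> N" "a \<oplus>\<^bsub>A\<^esub> b = \<one>\<^bsub>A\<^esub>"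
proof -
  interpret cring A by fact
  interpret M: maximalideal M A by fact
  interpret N: maximalideal N A by fact
  have "\<not> N \<subseteq> M"
    using N.I_maximal[OF M.is_ideal] M.a_subset \<open>M \<noteq> N\<close> M.I_notcarr by blast
  then obtain e where e: "e \<in> N" "e \<notin> M" by blast
  then obtain m c where "m \<in> M" "c \<in> carrier A" "m \<oplus>\<^bsub>A\<^esub> c \<otimes>\<^bsub>A\<^esub> e = \<one>\<^bsub>A\<^esub>"
    using maximalideal_comaximal[OF M, of e] N.Icarr by blast
  with that[of m "c \<otimes>\<^bsub>A\<^esub> e"] e N.I_l_closed show thesis by blast
qed

text \<open>Two distinct maximal ideals above a prime \<open>P\<close> would contain comaximal elements \<open>a\<close> and \<open>b\<close>. One
  factor of the splitting \<open>x y = 0\<close> lies in \<open>P\<close>, hence in both maximal ideals, and it is comaximal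
  with the element \<open>a\<close> or \<open>b\<close> of one of them.\<close>

lemma comaximal_splitting_imp_pm_ring:
  assumes "cring A" and spl: "comaximal_splitting A"
  shows "pm_ring A"
  unfolding pm_ring_def
proof (intro conjI ballI)
  show "cring A" by fact
  interpret cring A by fact
  fix P assume "P \<in> Spec A"
  then interpret P: primeideal P A by (simp add: Spec_def)
  obtain M where M: "maximalideal M A" "P \<subseteq> M"
    using exists_maximalideal[OF P.is_ideal] P.I_notcarr by metis
  have "N = M" if N: "maximalideal N A" "P \<subseteq> N" for N
  proof (rule ccontr)
    assume "N \<noteq> M"
    then obtain a b where ab: "a \<in> N" "b \<in> M" "a \<oplus>\<^bsub>A\<^esub> b = \<one>\<^bsub>A\<^esub>"
      using distinct_maximalideals_comaximal[OF \<open>cring A\<close> N(1) M(1)] by blast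
    interpret M: maximalideal M A by fact
    interpret N: maximalideal N A by fact
    obtain x y r s where xy: "x \<in> carrier A" "y \<in> carrier A" "r \<in> carrier A" "s \<in> carrier A"
      "x \<oplus>\<^bsub>A\<^esub> r \<otimes>\<^bsub>A\<^esub> a = \<one>\<^bsub>A\<^esub>" "y \<oplus>\<^bsub>A\<^esub> s \<otimes>\<^bsub>A\<^esub> b = \<one>\<^bsub>A\<^esub>" "x \<otimes>\<^bsub>A\<^esub> y = \<zero>\<^bsub>A\<^esub>"
      using comaximal_splittingE[OF spl N.Icarr[OF ab(1)] M.Icarr[OF ab(2)] ab(3)] by metis
    have "x \<notin> N" using N.not_mem_if_comaximal[OF _ ab(1) xy(3,5)] N.I_notcarr by metis
    moreover have "y \<notin> M" using M.not_mem_if_comaximal[OF _ ab(2) xy(4,6)] M.I_notcarr by metis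
    moreover have "x \<in> P \<or> y \<in> P"
      using P.I_prime[OF xy(1,2)] xy(7) P.zero_closed by metis
    ultimately show False using M(2) N(2) by blast
  qed
  then show "\<exists>!M. M \<in> Max_spec A \<and> P \<subseteq> M"
    using M unfolding Max_spec_def by blast
qed

lemma comaximal_splitting_hom_image:
  assumes A: "cring A" and B: "cring B" and f: "f \<in> ring_hom A B" "f ` carrier A = carrier B"
    and spl: "comaximal_splitting A"
  shows "comaximal_splitting B"
  unfolding comaximal_splitting_def
proof (intro ballI impI)
  interpret A: cring A by fact
  interpret B: cring B by fact
  interpret ring_hom_cring A B f
    by (intro ring_hom_cringI ring_hom_ringI2 A.ring_axioms B.ring_axioms f(1) A B)
  fix a b assume ab: "a \<in> carrier B" "b \<in> carrier B" "a \<oplus>\<^bsub>B\<^esub> b = \<one>\<^bsub>B\<^esub>"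
  then obtain a' where a': "a' \<in> carrier A" "a = f a'" using f(2) by auto
  define b' where "b' = \<ominus>\<^bsub>A\<^esub> a' \<oplus>\<^bsub>A\<^esub> \<one>\<^bsub>A\<^esub>"
  have b': "b' \<in> carrier A" "a' \<oplus>\<^bsub>A\<^esub> b' = \<one>\<^bsub>A\<^esub>"
    using a' by (auto simp: b'_def A.r_neg2)
  have "f a' \<oplus>\<^bsub>B\<^esub> f b' = f a' \<oplus>\<^bsub>B\<^esub> b"
    using a' b' ab hom_add hom_one by metis
  then have fb: "f b' = b" using a' b'(1) ab(2) by simp
  obtain x y r s where xy: "x \<in> carrier A" "y \<in> carrier A" "r \<in> carrier A" "s \<in> carrier A"
    "x \<oplus>\<^bsub>A\<^esub> r \<otimes>\<^bsub>A\<^esub> a' = \<one>\<^bsub>A\<^esub>" "y \<oplus>\<^bsub>A\<^esub> s \<otimes>\<^bsub>A\<^esub> b' = \<one>\<^bsub>A\<^esub>" "x \<otimes>\<^bsub>A\<^esub> y = \<zero>\<^bsub>A\<^esub>"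
    using comaximal_splittingE[OF spl a'(1) b'] by metis
  show "\<exists>x\<in>carrier B. \<exists>y\<in>carrier B. \<exists>r\<in>carrier B. \<exists>s\<in>carrier B.
      x \<oplus>\<^bsub>B\<^esub> r \<otimes>\<^bsub>B\<^esub> a = \<one>\<^bsub>B\<^esub> \<and> y \<oplus>\<^bsub>B\<^esub> s \<otimes>\<^bsub>B\<^esub> b = \<one>\<^bsub>B\<^esub> \<and> x \<otimes>\<^bsub>B\<^esub> y = \<zero>\<^bsub>B\<^esub>"
  proof (intro bexI conjI)
    show "f x \<oplus>\<^bsub>B\<^esub> f r \<otimes>\<^bsub>B\<^esub> a = \<one>\<^bsub>B\<^esub>"
      using arg_cong[OF xy(5), of f] xy(1,3) a' by simp
    show "f y \<oplus>\<^bsub>B\<^esub> f s \<otimes>\<^bsub>B\<^esub> b = \<one>\<^bsub>B\<^esub>"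
      using arg_cong[OF xy(6), of f] xy(2,4) b'(1) fb by simp
    show "f x \<otimes>\<^bsub>B\<^esub> f y = \<zero>\<^bsub>B\<^esub>"
      using arg_cong[OF xy(7), of f] xy(1,2) by simp
  qed (use xy in simp_all)
qed

lemma pm_ring_hom_image:
  assumes "pm_ring A" "cring B" "f \<in> ring_hom A B" "f ` carrier A = carrier B"
  shows "pm_ring B"
  using assms comaximal_splitting_hom_image comaximal_splitting_imp_pm_ring
    pm_ring_imp_comaximal_splitting pm_ring_def by metis

lemma retraction_mu:
  assumes "pm_ring A" "P \<in> Spec A"
  shows "retraction_mu A P \<in> Max_spec A" and "P \<subseteq> retraction_mu A P"
proof -
  have "\<exists>!M. M \<in> Max_spec A \<and> P \<subseteq> M" using assms by (simp add: pm_ring_def)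
  from theI'[OF this] show "retraction_mu A P \<in> Max_spec A" "P \<subseteq> retraction_mu A P"
    by (auto simp: retraction_mu_def)
qed

lemma retraction_mu_unique:
  assumes "pm_ring A" "P \<in> Spec A" "M \<in> Max_spec A" "P \<subseteq> M"
  shows "retraction_mu A P = M"
  using assms retraction_mu[OF assms(1,2)] unfolding pm_ring_def by blast

lemma Max_spec_subset_Spec: "cring A \<Longrightarrow> Max_spec A \<subseteq> Spec A"
  using cring.maximalideal_prime by (auto simp: Max_spec_def Spec_def)

section \<open>The maximal spectrum of a pm-ring\<close>

lemma topspace_zariski: "topspace (zariski A) = Spec A"
proof
  show "topspace (zariski A) \<subseteq> Spec A"
    using openin_topspace[of "zariski A"] unfolding openin_zariski by blast
  have "P \<noteq> carrier A" if "P \<in> Spec A" for P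
    using that primeideal.I_notcarr by (auto simp: Spec_def)
  moreover have "P \<subseteq> carrier A" if "P \<in> Spec A" for P
    using that by (auto simp: Spec_def primeideal_def dest: additive_subgroup.a_subset ideal.axioms(1))
  ultimately have "Spec A = Spec A - {P. carrier A \<subseteq> P}" by blast
  then have "openin (zariski A) (Spec A)" unfolding openin_zariski by blast
  then show "Spec A \<subseteq> topspace (zariski A)" by (rule openin_subset)
qed

lemma topspace_max_topology: "cring A \<Longrightarrow> topspace (max_topology A) = Max_spec A"
  using Max_spec_subset_Spec by (auto simp: max_topology_def topspace_zariski)

lemma openin_max_topology:
  assumes "cring A"
  shows "openin (max_topology A) U \<longleftrightarrow> (\<exists>E \<subseteq> carrier A. U = Max_spec A - {M. E \<subseteq> M})"
proof -
  have "(Spec A - {P. E \<subseteq> P}) \<inter> Max_spec A = Max_spec A - {M. E \<subseteq> M}" for E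
    using Max_spec_subset_Spec[OF assms] by blast
  then show ?thesis
    unfolding max_topology_def openin_subtopology openin_zariski by metis
qed

lemma openin_max_topology_basic:
  assumes "cring A" "e \<in> carrier A"
  shows "openin (max_topology A) {M \<in> Max_spec A. e \<notin> M}"
  unfolding openin_max_topology[OF assms(1)]
  by (rule exI[of _ "{e}"]) (use assms(2) in auto)

lemma Max_specD:
  assumes "M \<in> Max_spec A"
  shows "maximalideal M A" and "ideal M A" and "M \<subseteq> carrier A" and "M \<noteq> carrier A"
proof -
  show M: "maximalideal M A" using assms by (simp add: Max_spec_def)
  then show "ideal M A" by (rule maximalideal.axioms)
  then show "M \<subseteq> carrier A" using additive_subgroup.a_subset ideal.axioms(1) by blast
  show "M \<noteq> carrier A" using maximalideal.I_notcarr[OF M] by blast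
qed

text \<open>A splitting \<open>x y = 0\<close> for comaximal \<open>a \<in> M\<close>, \<open>b \<in> N\<close> makes the basic open sets where \<open>x\<close> and \<open>y\<close> do
  not vanish disjoint neighbourhoods of \<open>M\<close> and \<open>N\<close>.\<close>

lemma Hausdorff_space_max_topology:
  assumes pm: "pm_ring A"
  shows "Hausdorff_space (max_topology A)"
proof -
  have A: "cring A" using pm by (simp add: pm_ring_def)
  show ?thesis
    unfolding Hausdorff_space_def topspace_max_topology[OF A]
  proof (intro allI impI, elim conjE)
    fix M N assume M: "M \<in> Max_spec A" and N: "N \<in> Max_spec A" and "M \<noteq> N"
    then obtain a b where ab: "a \<in> M" "b \<in> N" "a \<oplus>\<^bsub>A\<^esub> b = \<one>\<^bsub>A\<^esub>"
      using distinct_maximalideals_comaximal[OF A Max_specD(1)[OF M] Max_specD(1)[OF N]] by blast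
    have abc: "a \<in> carrier A" "b \<in> carrier A" using ab M N Max_specD(3) by blast+
    obtain x y r s where xy: "x \<in> carrier A" "y \<in> carrier A" "r \<in> carrier A" "s \<in> carrier A"
      "x \<oplus>\<^bsub>A\<^esub> r \<otimes>\<^bsub>A\<^esub> a = \<one>\<^bsub>A\<^esub>" "y \<oplus>\<^bsub>A\<^esub> s \<otimes>\<^bsub>A\<^esub> b = \<one>\<^bsub>A\<^esub>" "x \<otimes>\<^bsub>A\<^esub> y = \<zero>\<^bsub>A\<^esub>"
      using comaximal_splittingE[OF pm_ring_imp_comaximal_splitting[OF pm] abc ab(3)] by metis
    have "x \<notin> M"
      using ideal.not_mem_if_comaximal[OF Max_specD(2)[OF M] Max_specD(4)[OF M] ab(1) xy(3,5)] .
    moreover have "y \<notin> N"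
      using ideal.not_mem_if_comaximal[OF Max_specD(2)[OF N] Max_specD(4)[OF N] ab(2) xy(4,6)] .
    moreover have "x \<in> L \<or> y \<in> L" if L: "L \<in> Max_spec A" for L
    proof -
      have "primeideal L A" using L Max_spec_subset_Spec[OF A] by (auto simp: Spec_def)
      moreover have "x \<otimes>\<^bsub>A\<^esub> y \<in> L"
        using xy(7) additive_subgroup.zero_closed ideal.axioms(1) Max_specD(2)[OF L] by metis
      ultimately show ?thesis using primeideal.I_prime xy(1,2) by metis
    qed
    ultimately show "\<exists>U V. openin (max_topology A) U \<and> openin (max_topology A) V \<and>
        M \<in> U \<and> N \<in> V \<and> disjnt U V"
      using openin_max_topology_basic[OF A xy(1)] openin_max_topology_basic[OF A xy(2)] M N
      by (intro exI[of _ "{L \<in> Max_spec A. x \<notin> L}"] exI[of _ "{L \<in> Max_spec A. y \<notin> L}"])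
        (auto simp: disjnt_def)
  qed
qed

text \<open>The algebraic content of quasi-compactness. The ideals generated by finite subsets of \<open>E\<close> are
  directed, so their union is an ideal containing \<open>E\<close>; it is not proper, hence \<open>1\<close> lies in one
  of them.\<close>

lemma (in cring) finite_subset_in_no_maximalideal:
  assumes E: "E \<subseteq> carrier R" and cov: "\<And>M. maximalideal M R \<Longrightarrow> \<not> E \<subseteq> M"
  obtains F where "finite F" "F \<subseteq> E" "\<And>M. maximalideal M R \<Longrightarrow> \<not> F \<subseteq> M"
proof -
  define \<F> where "\<F> = {Idl F | F. finite F \<and> F \<subseteq> E}"
  have Fc: "F \<subseteq> carrier R" if "F \<subseteq> E" for F using that E by blast
  have id: "ideal (\<Union>\<F>) R"
  proof (rule ideal_Union_directed)
    show "\<F> \<noteq> {}" by (auto simp: \<F>_def)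
    show "ideal I R" if "I \<in> \<F>" for I using that Fc genideal_ideal by (auto simp: \<F>_def)
    fix I J assume "I \<in> \<F>" "J \<in> \<F>"
    then obtain F G where FG: "I = Idl F" "finite F" "F \<subseteq> E" "J = Idl G" "finite G" "G \<subseteq> E"
      by (auto simp: \<F>_def)
    have "Idl (F \<union> G) \<in> \<F>" using FG unfolding \<F>_def by blast
    moreover have "I \<union> J \<subseteq> Idl (F \<union> G)"
      using FG subset_Idl_subset[of "F \<union> G"] Fc by simp
    ultimately show "\<exists>L\<in>\<F>. I \<union> J \<subseteq> L" by blast
  qed
  have "E \<subseteq> \<Union>\<F>"
  proof
    fix e assume e: "e \<in> E"
    then have "Idl {e} \<in> \<F>" unfolding \<F>_def by blast
    then show "e \<in> \<Union>\<F>" using genideal_self'[of e] e E by blast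
  qed
  then have "\<Union>\<F> = carrier R"
    using exists_maximalideal[OF id] cov by (metis subset_trans)
  then obtain F where F: "finite F" "F \<subseteq> E" "\<one> \<in> Idl F"
    using one_closed unfolding \<F>_def by blast
  have "\<not> F \<subseteq> M" if M: "maximalideal M R" for M
  proof
    assume "F \<subseteq> M"
    then have "\<one> \<in> M" using F(3) genideal_minimal[OF maximalideal.axioms(1)[OF M]] by blast
    then show False
      using ideal.one_imp_carrier maximalideal.axioms(1) maximalideal.I_notcarr M by metis
  qed
  with F that show thesis by blast
qed

lemma compact_space_max_topology:
  assumes A: "cring A"
  shows "compact_space (max_topology A)"
  unfolding compact_space_alt topspace_max_topology[OF A]
proof (intro allI impI, elim conjE)
  fix \<U> assume op: "\<forall>U\<in>\<U>. openin (max_topology A) U" and cov: "Max_spec A \<subseteq> \<Union>\<U>"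
  obtain e where e: "\<And>U. U \<in> \<U> \<Longrightarrow> e U \<subseteq> carrier A \<and> U = Max_spec A - {M. e U \<subseteq> M}"
    using op unfolding openin_max_topology[OF A] by metis
  have "\<not> \<Union>(e ` \<U>) \<subseteq> M" if M: "maximalideal M A" for M
  proof -
    obtain U where "U \<in> \<U>" "M \<in> U" using M cov by (auto simp: Max_spec_def)
    then show ?thesis using e by blast
  qed
  moreover have "\<Union>(e ` \<U>) \<subseteq> carrier A" using e by blast
  ultimately obtain F where F: "finite F" "F \<subseteq> \<Union>(e ` \<U>)"
      "\<And>M. maximalideal M A \<Longrightarrow> \<not> F \<subseteq> M"
    using cring.finite_subset_in_no_maximalideal[OF A, of "\<Union>(e ` \<U>)"] by metis
  obtain \<G> where \<G>: "finite \<G>" "\<G> \<subseteq> e ` \<U>" "F \<subseteq> \<Union>\<G>"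
    using finite_subset_Union[OF F(1,2)] by metis
  obtain \<V> where \<V>: "\<V> \<subseteq> \<U>" "finite \<V>" "\<G> = e ` \<V>"
    using finite_subset_image[OF \<G>(1,2)] by blast
  have "M \<in> \<Union>\<V>" if M: "M \<in> Max_spec A" for M
  proof -
    obtain x where "x \<in> F" "x \<notin> M" using F(3) M by (auto simp: Max_spec_def)
    then obtain U where "U \<in> \<V>" "x \<in> e U" using \<G>(3) \<V>(3) by blast
    then show ?thesis using e \<V>(1) M \<open>x \<notin> M\<close> by blast
  qed
  with \<V>(1,2) show "\<exists>\<F>. finite \<F> \<and> \<F> \<subseteq> \<U> \<and> Max_spec A \<subseteq> \<Union>\<F>" by blast
qed

section \<open>Maps of maximal spectra induced by ring homomorphisms\<close>

text \<open>The map \<open>N \<mapsto> \<mu>(f\<^sup>-\<^sup>1(N))\<close>. The spectral map of an endomorphism is the case \<open>A = B\<close>; allowing two rings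
  makes functoriality available for the comparison of endomorphisms of different rings.\<close>

definition induced_max_map ::
  "('a, 'm) ring_scheme \<Rightarrow> ('b, 'n) ring_scheme \<Rightarrow> ('a \<Rightarrow> 'b) \<Rightarrow> 'b set \<Rightarrow> 'a set" where
  "induced_max_map A B f = (\<lambda>N \<in> Max_spec B. retraction_mu A {x \<in> carrier A. f x \<in> N})"

lemma spectral_map_eq_induced: "spectral_map A f = induced_max_map A A f"
  by (simp add: spectral_map_def induced_max_map_def)

lemma induced_max_map_cong:
  assumes "\<And>x. x \<in> carrier A \<Longrightarrow> f x = g x"
  shows "induced_max_map A B f = induced_max_map A B g"
proof -
  have "{x \<in> carrier A. f x \<in> N} = {x \<in> carrier A. g x \<in> N}" for N
    using assms by auto
  then show ?thesis by (simp add: induced_max_map_def)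
qed

lemma preimage_mem_Spec:
  assumes A: "cring A" and B: "cring B" and f: "f \<in> ring_hom A B" and P: "P \<in> Spec B"
  shows "{x \<in> carrier A. f x \<in> P} \<in> Spec A"
proof -
  have "ring_hom_ring A B f"
    using A B f by (intro ring_hom_ringI2) (auto simp: cring_def)
  from ring_hom_ring.primeideal_vimage[OF this A] P show ?thesis by (simp add: Spec_def)
qed

lemma induced_max_map:
  assumes A: "pm_ring A" and B: "cring B" and f: "f \<in> ring_hom A B" and N: "N \<in> Max_spec B"
  shows "induced_max_map A B f N \<in> Max_spec A"
    and "{x \<in> carrier A. f x \<in> N} \<subseteq> induced_max_map A B f N"
proof -
  have "{x \<in> carrier A. f x \<in> N} \<in> Spec A"
    using A preimage_mem_Spec[OF _ B f] N Max_spec_subset_Spec[OF B] by (auto simp: pm_ring_def)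
  from retraction_mu[OF A this] N
  show "induced_max_map A B f N \<in> Max_spec A"
    and "{x \<in> carrier A. f x \<in> N} \<subseteq> induced_max_map A B f N"
    by (simp_all add: induced_max_map_def)
qed

text \<open>Any prime \<open>P\<close> below \<open>f\<^sup>-\<^sup>1(N)\<close> already determines \<open>\<mu>(f\<^sup>-\<^sup>1(N))\<close>, since the latter is the only maximal
  ideal above \<open>P\<close>.\<close>

lemma induced_max_map_eqI:
  assumes A: "pm_ring A" and B: "cring B" and f: "f \<in> ring_hom A B" and N: "N \<in> Max_spec B"
    and M: "M \<in> Max_spec A" and P: "P \<in> Spec A" "P \<subseteq> M" "P \<subseteq> {x \<in> carrier A. f x \<in> N}"
  shows "induced_max_map A B f N = M"
  using retraction_mu_unique[OF A P(1) M P(2)]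
    retraction_mu_unique[OF A P(1) induced_max_map(1)[OF A B f N]]
    induced_max_map(2)[OF A B f N] P(3)
  by (metis subset_trans)

text \<open>The prime \<open>(g f)\<^sup>-\<^sup>1(N) = f\<^sup>-\<^sup>1(g\<^sup>-\<^sup>1(N))\<close> is contained in \<open>f\<^sup>-\<^sup>1(\<mu>(g\<^sup>-\<^sup>1(N)))\<close>, so it lies below both
  sides.\<close>

lemma induced_max_map_comp:
  assumes A: "pm_ring A" and B: "pm_ring B" and C: "cring C"
    and f: "f \<in> ring_hom A B" and g: "g \<in> ring_hom B C" and N: "N \<in> Max_spec C"
  shows "induced_max_map A C (g \<circ> f) N = induced_max_map A B f (induced_max_map B C g N)"
proof (rule induced_max_map_eqI[OF A C _ N])
  have cA: "cring A" and cB: "cring B" using A B by (auto simp: pm_ring_def)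
  show gf: "g \<circ> f \<in> ring_hom A C" by (rule ring_hom_trans[OF f g])
  note gN = induced_max_map[OF B C g N]
  note fgN = induced_max_map[OF A cB f gN(1)]
  show "induced_max_map A B f (induced_max_map B C g N) \<in> Max_spec A" by (rule fgN)
  show "{x \<in> carrier A. (g \<circ> f) x \<in> N} \<in> Spec A"
    using preimage_mem_Spec[OF cA C gf] N Max_spec_subset_Spec[OF C] by blast
  show "{x \<in> carrier A. (g \<circ> f) x \<in> N} \<subseteq> induced_max_map A B f (induced_max_map B C g N)"
    using gN(2) fgN(2) ring_hom_closed[OF f] by fastforce
qed simp

text \<open>Let \<open>p\<close> be the induced map and \<open>e\<close> an element outside \<open>p(N)\<close>. Maximality gives \<open>m + c e = 1\<close> with
  \<open>m \<in> p(N)\<close>; split this as \<open>x y = 0\<close>. Then \<open>x\<close> is not in \<open>p(N)\<close>, so \<open>f(x) \<notin> N\<close>, and this condition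
  defines the required neighbourhood of \<open>N\<close>: if \<open>f(x) \<notin> N'\<close>, the prime \<open>f\<^sup>-\<^sup>1(N')\<close> contains \<open>y\<close>, hence
  \<open>p(N')\<close> contains \<open>y\<close>, and so does not contain \<open>c e\<close>.\<close>

lemma continuous_induced_max_map:
  assumes pm: "pm_ring A" and B: "cring B" and f: "f \<in> ring_hom A B"
  shows "continuous_map (max_topology B) (max_topology A) (induced_max_map A B f)"
proof -
  have A: "cring A" using pm by (simp add: pm_ring_def)
  let ?p = "induced_max_map A B f"
  have "openin (max_topology B) {N \<in> Max_spec B. ?p N \<in> U}" if U: "openin (max_topology A) U" for U
  proof (subst openin_subopen, rule ballI)
    fix N assume "N \<in> {N \<in> Max_spec B. ?p N \<in> U}"
    then have N: "N \<in> Max_spec B" "?p N \<in> U" by auto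
    obtain E where E: "E \<subseteq> carrier A" "U = Max_spec A - {M. E \<subseteq> M}"
      using U unfolding openin_max_topology[OF A] by blast
    obtain e where e: "e \<in> E" "e \<notin> ?p N" using N(2) E(2) by blast
    have ec: "e \<in> carrier A" using e E by blast
    note pN = induced_max_map[OF pm B f N(1)]
    obtain m c where mc: "m \<in> ?p N" "c \<in> carrier A" "m \<oplus>\<^bsub>A\<^esub> c \<otimes>\<^bsub>A\<^esub> e = \<one>\<^bsub>A\<^esub>"
      using cring.maximalideal_comaximal[OF A Max_specD(1)[OF pN(1)] ec e(2)] by blast
    have carr: "m \<in> carrier A" "c \<otimes>\<^bsub>A\<^esub> e \<in> carrier A"
      using mc Max_specD(3)[OF pN(1)] ec A by (auto intro: monoid.m_closed simp: cring_def ring_def)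
    obtain x y r s where xy: "x \<in> carrier A" "y \<in> carrier A" "r \<in> carrier A" "s \<in> carrier A"
      "x \<oplus>\<^bsub>A\<^esub> r \<otimes>\<^bsub>A\<^esub> m = \<one>\<^bsub>A\<^esub>" "y \<oplus>\<^bsub>A\<^esub> s \<otimes>\<^bsub>A\<^esub> (c \<otimes>\<^bsub>A\<^esub> e) = \<one>\<^bsub>A\<^esub>"
      "x \<otimes>\<^bsub>A\<^esub> y = \<zero>\<^bsub>A\<^esub>"
      using comaximal_splittingE[OF pm_ring_imp_comaximal_splitting[OF pm] carr mc(3)] by metis
    have "x \<notin> ?p N"
      using ideal.not_mem_if_comaximal[OF Max_specD(2)[OF pN(1)] Max_specD(4)[OF pN(1)] mc(1) xy(3,5)] .
    then have "f x \<notin> N" using pN(2) xy(1) by blast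
    moreover have "?p N' \<in> U" if N': "N' \<in> Max_spec B" "f x \<notin> N'" for N'
    proof -
      note pN' = induced_max_map[OF pm B f N'(1)]
      let ?P = "{x \<in> carrier A. f x \<in> N'}"
      have P: "primeideal ?P A"
        using preimage_mem_Spec[OF A B f] N'(1) Max_spec_subset_Spec[OF B] by (auto simp: Spec_def)
      then have "x \<otimes>\<^bsub>A\<^esub> y \<in> ?P"
        using xy(7) additive_subgroup.zero_closed ideal.axioms(1) primeideal.axioms(1) by metis
      then have "y \<in> ?P" using primeideal.I_prime[OF P xy(1,2)] N'(2) by blast
      then have "y \<in> ?p N'" using pN'(2) by blast
      then have "c \<otimes>\<^bsub>A\<^esub> e \<notin> ?p N'"
        using ideal.not_mem_if_comaximal[OF Max_specD(2)[OF pN'(1)] Max_specD(4)[OF pN'(1)] _ xy(4,6)]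
        by blast
      then have "e \<notin> ?p N'" using ideal.I_l_closed[OF Max_specD(2)[OF pN'(1)] _ mc(2)] by blast
      then show ?thesis using e(1) pN'(1) E(2) by blast
    qed
    moreover have "f x \<in> carrier B" using ring_hom_closed[OF f xy(1)] .
    ultimately show "\<exists>T. openin (max_topology B) T \<and> N \<in> T \<and> T \<subseteq> {N \<in> Max_spec B. ?p N \<in> U}"
      using openin_max_topology_basic[OF B] N(1)
      by (intro exI[of _ "{N' \<in> Max_spec B. f x \<notin> N'}"]) auto
  qed
  then show ?thesis
    using induced_max_map(1)[OF pm B f]
    by (simp add: continuous_map_def topspace_max_topology A B)
qed

text \<open>Let \<open>M\<close> be a maximal ideal of \<open>A\<close>. Injectivity of \<open>f\<close> keeps \<open>0\<close> out of the multiplicative set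
  \<open>f(A - M)\<close>, so some prime \<open>P\<close> of \<open>B\<close> avoids it, that is, \<open>f\<^sup>-\<^sup>1(P) \<subseteq> M\<close>. Every maximal ideal above \<open>P\<close>
  is then mapped to \<open>M\<close>.\<close>

lemma induced_max_map_surj:
  assumes A: "pm_ring A" and B: "cring B" and f: "f \<in> ring_hom A B" "inj_on f (carrier A)"
  shows "induced_max_map A B f ` Max_spec B = Max_spec A"
proof
  show "induced_max_map A B f ` Max_spec B \<subseteq> Max_spec A"
    using induced_max_map(1)[OF A B f(1)] by blast
  show "Max_spec A \<subseteq> induced_max_map A B f ` Max_spec B"
  proof
    fix M assume M: "M \<in> Max_spec A"
    have cA: "cring A" using A by (simp add: pm_ring_def)
    interpret A: cring A by fact
    interpret B: cring B by fact
    interpret f: ring_hom_cring A B f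
      by (intro ring_hom_cringI ring_hom_ringI2 A.ring_axioms B.ring_axioms f(1) cA B)
    have "primeideal M A" using M Max_spec_subset_Spec[OF cA] by (auto simp: Spec_def)
    then interpret M: primeideal M A .
    let ?S = "f ` (carrier A - M)"
    have dis: "{\<zero>\<^bsub>B\<^esub>} \<inter> ?S = {}"
    proof -
      have "\<zero>\<^bsub>B\<^esub> \<noteq> f a" if a: "a \<in> carrier A" "a \<notin> M" for a
        using inj_onD[OF f(2), of a "\<zero>\<^bsub>A\<^esub>"] a f.hom_zero M.zero_closed by auto
      then show ?thesis by blast
    qed
    have "\<one>\<^bsub>A\<^esub> \<notin> M" using M.one_imp_carrier M.I_notcarr by blast
    then have one: "\<one>\<^bsub>B\<^esub> \<in> ?S" using f.hom_one A.one_closed by (metis DiffI image_eqI)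
    have mult: "u \<otimes>\<^bsub>B\<^esub> v \<in> ?S" if uv: "u \<in> ?S" "v \<in> ?S" for u v
    proof -
      obtain a b where ab: "u = f a" "v = f b" "a \<in> carrier A" "b \<in> carrier A" "a \<notin> M" "b \<notin> M"
        using uv by blast
      then have "u \<otimes>\<^bsub>B\<^esub> v = f (a \<otimes>\<^bsub>A\<^esub> b)" "a \<otimes>\<^bsub>A\<^esub> b \<in> carrier A - M"
        using M.I_prime by auto
      then show ?thesis by blast
    qed
    obtain P where P: "primeideal P B" "P \<inter> ?S = {}"
      by (rule B.exists_primeideal_avoiding[OF B.zeroideal dis one]) (auto intro: mult)
    obtain N where N: "maximalideal N B" "P \<subseteq> N"
      using B.exists_maximalideal[of P] P(1) primeideal.axioms(1) primeideal.I_notcarr by metis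
    have NM: "N \<in> Max_spec B" using N by (simp add: Max_spec_def)
    have "{x \<in> carrier A. f x \<in> P} \<in> Spec A"
      using preimage_mem_Spec[OF cA B f(1)] P(1) by (simp add: Spec_def)
    then have "induced_max_map A B f N = M"
      by (rule induced_max_map_eqI[OF A B f(1) NM M]) (use P(2) N(2) in auto)
    with NM show "M \<in> induced_max_map A B f ` Max_spec B" by blast
  qed
qed

lemma induced_max_map_extensional: "induced_max_map A B f \<in> extensional (Max_spec B)"
  by (simp add: induced_max_map_def)

section \<open>Descending self-maps along a surjection\<close>

lemma topspace_compact_open: "topspace (compact_open_topology X Y) = cts_maps X Y"
proof -
  let ?S = "{{f \<in> cts_maps X Y. f ` C \<subseteq> U} | C U. compactin X C \<and> openin Y U}"
  have "{f \<in> cts_maps X Y. f ` {} \<subseteq> {}} \<in> ?S"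
    using compactin_empty openin_empty by blast
  then have "cts_maps X Y \<in> ?S" by simp
  then show ?thesis
    unfolding compact_open_topology_def topology_generated_by_topspace by blast
qed

lemma openin_compact_open:
  assumes "compactin X C" "openin Y U"
  shows "openin (compact_open_topology X Y) {f \<in> cts_maps X Y. f ` C \<subseteq> U}"
  unfolding compact_open_topology_def
  by (rule topology_generated_by_Basis) (use assms in blast)

text \<open>The map \<open>v\<close> with \<open>v \<circ> p = p \<circ> u\<close>, whenever there is one and \<open>p\<close> is onto. Choosing preimages under
  \<open>p\<close> makes it a function of \<open>u\<close> alone; by \<open>descend_eqI\<close> the choice does not affect its value.\<close>

definition descend :: "'a topology \<Rightarrow> 'b topology \<Rightarrow> ('a \<Rightarrow> 'b) \<Rightarrow> ('a \<Rightarrow> 'a) \<Rightarrow> 'b \<Rightarrow> 'b" where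
  "descend X Y p u = (\<lambda>y \<in> topspace Y. p (u (inv_into (topspace X) p y)))"

lemma descend_eqI:
  assumes surj: "p ` topspace X = topspace Y" and v: "v \<in> extensional (topspace Y)"
    and com: "\<And>x. x \<in> topspace X \<Longrightarrow> v (p x) = p (u x)"
  shows "descend X Y p u = v"
proof (rule extensionalityI[of _ "topspace Y"])
  show "descend X Y p u \<in> extensional (topspace Y)" by (simp add: descend_def)
  fix y assume y: "y \<in> topspace Y"
  then have "inv_into (topspace X) p y \<in> topspace X" "p (inv_into (topspace X) p y) = y"
    using surj by (auto intro: inv_into_into f_inv_into_f)
  then show "descend X Y p u y = v y"
    using com y by (metis descend_def restrict_apply')
qed fact

lemma Int_eqI: "(\<And>x. x \<in> F \<Longrightarrow> x \<in> S \<longleftrightarrow> x \<in> T) \<Longrightarrow> S \<inter> F = T \<inter> F"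
  by blast

text \<open>The preimage of the subbasic set of all \<open>v\<close> with \<open>v(C) \<subseteq> U\<close> consists of the \<open>u\<close> with
  \<open>u(p\<^sup>-\<^sup>1(C)) \<subseteq> p\<^sup>-\<^sup>1(U)\<close>. The set \<open>C\<close> is closed because \<open>Y\<close> is Hausdorff, so \<open>p\<^sup>-\<^sup>1(C)\<close> is closed in the
  compact space \<open>X\<close>, hence compact.\<close>

lemma continuous_map_descend:
  assumes X: "compact_space X" and Y: "Hausdorff_space Y"
    and p: "continuous_map X Y p" "p ` topspace X = topspace Y"
    and F: "F \<subseteq> cts_maps X X" and G: "G \<subseteq> cts_maps Y Y"
    and ex: "\<And>u. u \<in> F \<Longrightarrow> \<exists>v\<in>G. \<forall>x\<in>topspace X. v (p x) = p (u x)"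
  shows "continuous_map (subtopology (compact_open_topology X X) F)
    (subtopology (compact_open_topology Y Y) G) (descend X Y p)"
proof -
  have d: "descend X Y p u \<in> G" "\<And>x. x \<in> topspace X \<Longrightarrow> descend X Y p u (p x) = p (u x)"
    if u: "u \<in> F" for u
  proof -
    obtain v where v: "v \<in> G" "\<forall>x\<in>topspace X. v (p x) = p (u x)" using ex[OF u] by blast
    then have "v \<in> extensional (topspace Y)" using G by (auto simp: cts_maps_def)
    then have "descend X Y p u = v" using descend_eqI[OF p(2), of v u] v(2) by blast
    with v show "descend X Y p u \<in> G"
      "\<And>x. x \<in> topspace X \<Longrightarrow> descend X Y p u (p x) = p (u x)" by auto
  qed
  have top: "topspace (subtopology (compact_open_topology X X) F) = F"
    using F by (auto simp: topspace_compact_open)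
  have pre: "openin (subtopology (compact_open_topology X X) F)
      (descend X Y p -` {v \<in> cts_maps Y Y. v ` C \<subseteq> U} \<inter> F)"
    if C: "compactin Y C" and U: "openin Y U" for C U
  proof -
    let ?C = "{x \<in> topspace X. p x \<in> C}" and ?U = "{x \<in> topspace X. p x \<in> U}"
    have "compactin X ?C"
      using closedin_compact_space[OF X] closedin_continuous_map_preimage[OF p(1)]
        compactin_imp_closedin[OF Y C] by blast
    moreover have "openin X ?U" using openin_continuous_map_preimage[OF p(1) U] .
    ultimately have op: "openin (compact_open_topology X X) {u \<in> cts_maps X X. u ` ?C \<subseteq> ?U}"
      by (rule openin_compact_open)
    have CY: "C \<subseteq> p ` topspace X" using compactin_subset_topspace[OF C] p(2) by simp
    have iff: "descend X Y p u ` C \<subseteq> U \<longleftrightarrow> u ` ?C \<subseteq> ?U" if u: "u \<in> F" for u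
    proof -
      have ux: "u x \<in> topspace X" if "x \<in> topspace X" for x
        using u F that by (auto simp: cts_maps_def continuous_map_def)
      have C_eq: "C = p ` ?C" using CY by blast
      have "descend X Y p u ` C \<subseteq> U \<longleftrightarrow> (\<forall>x\<in>?C. descend X Y p u (p x) \<in> U)"
        by (subst C_eq) (simp only: image_subset_iff ball_simps)
      also have "\<dots> \<longleftrightarrow> (\<forall>x\<in>?C. p (u x) \<in> U)" using d(2)[OF u] by simp
      also have "\<dots> \<longleftrightarrow> u ` ?C \<subseteq> ?U" using ux by auto
      finally show ?thesis .
    qed
    have "u \<in> descend X Y p -` {v \<in> cts_maps Y Y. v ` C \<subseteq> U} \<longleftrightarrow> u \<in> {u \<in> cts_maps X X. u ` ?C \<subseteq> ?U}"
      if u: "u \<in> F" for u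
      using iff[OF u] subsetD[OF F u] subsetD[OF G d(1)[OF u]] by simp
    then have "descend X Y p -` {v \<in> cts_maps Y Y. v ` C \<subseteq> U} \<inter> F = {u \<in> cts_maps X X. u ` ?C \<subseteq> ?U} \<inter> F"
      by (rule Int_eqI)
    then show ?thesis using op by (auto simp: openin_subtopology)
  qed
  show ?thesis
  proof (rule continuous_map_into_subtopology)
    show "continuous_map (subtopology (compact_open_topology X X) F) (compact_open_topology Y Y) (descend X Y p)"
      unfolding compact_open_topology_def[of Y Y]
    proof (rule continuous_on_generated_topo)
      fix W assume "W \<in> {{f \<in> cts_maps Y Y. f ` C \<subseteq> U} |C U. compactin Y C \<and> openin Y U}"
      then show "openin (subtopology (compact_open_topology X X) F)
          (descend X Y p -` W \<inter> topspace (subtopology (compact_open_topology X X) F))"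
        unfolding top using pre by blast
    next
      have "\<Union> {{f \<in> cts_maps Y Y. f ` C \<subseteq> U} |C U. compactin Y C \<and> openin Y U} = cts_maps Y Y"
        using topspace_compact_open[of Y Y]
        unfolding compact_open_topology_def topology_generated_by_topspace .
      then show "descend X Y p ` topspace (subtopology (compact_open_topology X X) F)
          \<subseteq> \<Union> {{f \<in> cts_maps Y Y. f ` C \<subseteq> U} |C U. compactin Y C \<and> openin Y U}"
        unfolding top using d(1) G by blast
    qed
    show "descend X Y p \<in> topspace (subtopology (compact_open_topology X X) F) \<rightarrow> G"
      unfolding top using d(1) by blast
  qed
qed

section \<open>Spectral spaces along an injective homomorphism\<close>

lemma spectral_map_cts:
  assumes "pm_ring A" "f \<in> alg_endo K A"
  shows "spectral_map A f \<in> cts_maps (max_topology A) (max_topology A)"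
  using assms continuous_induced_max_map[of A A f] induced_max_map_extensional[of A A f]
  by (auto simp: spectral_map_eq_induced cts_maps_def topspace_max_topology pm_ring_def alg_hom_def)

lemma topspace_spectral_space:
  assumes "pm_ring A"
  shows "topspace (spectral_space K A) = spectral_map A ` alg_endo K A"
  using spectral_map_cts[OF assms]
  by (auto simp: spectral_space_def topspace_compact_open)

text \<open>When \<open>j\<close> embeds \<open>D\<close> as a subring of \<open>B\<close> that \<open>f\<close> maps to itself, this takes the spectral map of \<open>f\<close> to that of
  its restriction to \<open>D\<close>; see \<open>spectral_restriction_spectral_map\<close>.\<close>

definition spectral_restriction ::
  "('a, 'm) ring_scheme \<Rightarrow> ('b, 'n) ring_scheme \<Rightarrow> ('a \<Rightarrow> 'b) \<Rightarrow> ('b set \<Rightarrow> 'b set) \<Rightarrow> 'a set \<Rightarrow> 'a set" where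
  "spectral_restriction D B j = descend (max_topology B) (max_topology D) (induced_max_map D B j)"

text \<open>Functoriality applied to both sides of \<open>j g = f j\<close>.\<close>

lemma spectral_map_intertwine:
  assumes D: "pm_ring D" and B: "pm_ring B" and j: "j \<in> ring_hom D B"
    and f: "f \<in> alg_endo K B" and g: "g \<in> alg_endo K D"
    and jg: "\<And>x. x \<in> carrier D \<Longrightarrow> j (g x) = f (j x)" and N: "N \<in> Max_spec B"
  shows "spectral_map D g (induced_max_map D B j N) = induced_max_map D B j (spectral_map B f N)"
proof -
  have cB: "cring B" using B by (simp add: pm_ring_def)
  have fr: "f \<in> ring_hom B B" and gr: "g \<in> ring_hom D D" using f g by (auto simp: alg_hom_def)
  show ?thesis
    unfolding spectral_map_eq_induced
      induced_max_map_comp[OF D D cB gr j N, symmetric] induced_max_map_comp[OF D B cB j fr N, symmetric]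
    by (rule fun_cong[OF induced_max_map_cong]) (simp add: jg)
qed

lemma spectral_restriction_spectral_map:
  assumes D: "pm_ring D" and B: "pm_ring B" and j: "j \<in> ring_hom D B" "inj_on j (carrier D)"
    and f: "f \<in> alg_endo K B" and g: "g \<in> alg_endo K D"
    and jg: "\<And>x. x \<in> carrier D \<Longrightarrow> j (g x) = f (j x)"
  shows "spectral_restriction D B j (spectral_map B f) = spectral_map D g"
  unfolding spectral_restriction_def
proof (rule descend_eqI)
  have c: "cring D" "cring B" using D B by (auto simp: pm_ring_def)
  show "induced_max_map D B j ` topspace (max_topology B) = topspace (max_topology D)"
    using induced_max_map_surj[OF D c(2) j] by (simp add: topspace_max_topology c)
  show "spectral_map D g \<in> extensional (topspace (max_topology D))"
    using spectral_map_cts[OF D g] by (simp add: cts_maps_def)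
  show "spectral_map D g (induced_max_map D B j N) = induced_max_map D B j (spectral_map B f N)"
    if "N \<in> topspace (max_topology B)" for N
    using spectral_map_intertwine[OF D B j(1) f g jg] that by (simp add: topspace_max_topology c)
qed

lemma continuous_map_spectral_restriction:
  assumes D: "pm_ring D" and B: "pm_ring B" and j: "j \<in> ring_hom D B" "inj_on j (carrier D)"
    and ex: "\<And>f. f \<in> alg_endo K B \<Longrightarrow> \<exists>g \<in> alg_endo K D. \<forall>x \<in> carrier D. j (g x) = f (j x)"
  shows "continuous_map (spectral_space K B) (spectral_space K D) (spectral_restriction D B j)"
  unfolding spectral_restriction_def spectral_space_def
proof (rule continuous_map_descend)
  have c: "cring D" "cring B" using D B by (auto simp: pm_ring_def)
  show "compact_space (max_topology B)" by (rule compact_space_max_topology[OF c(2)])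
  show "Hausdorff_space (max_topology D)" by (rule Hausdorff_space_max_topology[OF D])
  show "continuous_map (max_topology B) (max_topology D) (induced_max_map D B j)"
    by (rule continuous_induced_max_map[OF D c(2) j(1)])
  show "induced_max_map D B j ` topspace (max_topology B) = topspace (max_topology D)"
    using induced_max_map_surj[OF D c(2) j] by (simp add: topspace_max_topology c)
  show "spectral_map B ` alg_endo K B \<subseteq> cts_maps (max_topology B) (max_topology B)"
    using spectral_map_cts[OF B] by blast
  show "spectral_map D ` alg_endo K D \<subseteq> cts_maps (max_topology D) (max_topology D)"
    using spectral_map_cts[OF D] by blast
  fix u assume "u \<in> spectral_map B ` alg_endo K B"
  then obtain f where f: "f \<in> alg_endo K B" "u = spectral_map B f" by blast
  obtain g where g: "g \<in> alg_endo K D" "\<forall>x \<in> carrier D. j (g x) = f (j x)" using ex[OF f(1)] by blast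
  have "spectral_map D g (induced_max_map D B j N) = induced_max_map D B j (u N)"
    if "N \<in> topspace (max_topology B)" for N
    using spectral_map_intertwine[OF D B j(1) f(1) g(1)] g(2) that f(2) by (simp add: topspace_max_topology c)
  with g(1) show "\<exists>v\<in>spectral_map D ` alg_endo K D. \<forall>N\<in>topspace (max_topology B).
      v (induced_max_map D B j N) = induced_max_map D B j (u N)" by blast
qed

section \<open>Functoriality of the fundamental group\<close>

lemma loop_homotopic_loops:
  "(p, q) \<in> loop_homotopic X x \<Longrightarrow> p \<in> loops X x" "(p, q) \<in> loop_homotopic X x \<Longrightarrow> q \<in> loops X x"
  by (auto simp: loop_homotopic_def)

lemma loop_homotopicI:
  assumes "homotopic_with (\<lambda>r. r 0 = x \<and> r 1 = x) (top_of_set {0..1}) X p q"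
  shows "(p, q) \<in> loop_homotopic X x"
  using assms homotopic_with_imp_continuous_maps[OF assms] homotopic_with_imp_property[OF assms]
  by (auto simp: loop_homotopic_def loops_def pathin_def)

lemma equiv_loop_homotopic: "equiv (loops X x) (loop_homotopic X x)"
proof (rule equivI)
  show "loop_homotopic X x \<subseteq> loops X x \<times> loops X x"
    by (auto simp: loop_homotopic_def)
  show "refl_on (loops X x) (loop_homotopic X x)"
    by (auto simp: refl_on_def loop_homotopic_def loops_def pathin_def)
  show "sym (loop_homotopic X x)"
    by (auto simp: sym_def loop_homotopic_def homotopic_with_sym)
  show "trans (loop_homotopic X x)"
    by (auto simp: trans_def loop_homotopic_def intro: homotopic_with_trans)
qed

lemma loop_class_eq_iff:
  assumes "p \<in> loops X x" "q \<in> loops X x"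
  shows "loop_class X x p = loop_class X x q \<longleftrightarrow> (p, q) \<in> loop_homotopic X x"
  unfolding loop_class_def using eq_equiv_class_iff[OF equiv_loop_homotopic assms] .

lemma loop_class_self: "p \<in> loops X x \<Longrightarrow> p \<in> loop_class X x p"
  unfolding loop_class_def by (rule equiv_class_self[OF equiv_loop_homotopic])

lemma loop_classD: "q \<in> loop_class X x p \<Longrightarrow> (p, q) \<in> loop_homotopic X x"
  by (simp add: loop_class_def)

text \<open>Concatenating two based homotopies in the loop parameter; they agree at the junction because both
  are stationary at the base point there.\<close>

lemma loop_homotopic_concat:
  assumes pp: "(p, p') \<in> loop_homotopic X x" and qq: "(q, q') \<in> loop_homotopic X x"
  shows "(concat_paths p q, concat_paths p' q') \<in> loop_homotopic X x"
proof (rule loop_homotopicI)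
  let ?I = "top_of_set {0..1::real}"
  let ?II = "prod_topology ?I ?I"
  obtain H1 where H1: "continuous_map ?II X H1" "\<And>s. H1 (0, s) = p s" "\<And>s. H1 (1, s) = p' s"
      "\<And>t. t \<in> {0..1} \<Longrightarrow> H1 (t, 0) = x \<and> H1 (t, 1) = x"
    using pp unfolding loop_homotopic_def homotopic_with_def by auto
  obtain H2 where H2: "continuous_map ?II X H2" "\<And>s. H2 (0, s) = q s" "\<And>s. H2 (1, s) = q' s"
      "\<And>t. t \<in> {0..1} \<Longrightarrow> H2 (t, 0) = x \<and> H2 (t, 1) = x"
    using qq unfolding loop_homotopic_def homotopic_with_def by auto
  define H where "H = (\<lambda>z. if snd z \<le> 1/2 then (H1 \<circ> (\<lambda>z. (fst z, 2 * snd z))) z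
                              else (H2 \<circ> (\<lambda>z. (fst z, 2 * snd z - 1))) z)"
  show "homotopic_with (\<lambda>r. r 0 = x \<and> r 1 = x) ?I X (concat_paths p q) (concat_paths p' q')"
    unfolding homotopic_with_def
  proof (intro exI conjI allI ballI)
    show "continuous_map ?II X H"
      unfolding H_def
    proof (rule continuous_map_cases_le)
      have II: "?II = top_of_set ({0..1} \<times> {0..1})"
        by (simp add: prod_topology_subtopology euclidean_product_topology subtopology_subtopology)
          (rule arg_cong[where f = top_of_set], auto)
      show "continuous_map ?II euclideanreal snd" "continuous_map ?II euclideanreal (\<lambda>z. 1/2)"
        unfolding II by (auto intro: continuous_intros)
      show "continuous_map (subtopology ?II {z \<in> topspace ?II. snd z \<le> 1/2}) X
          (H1 \<circ> (\<lambda>z. (fst z, 2 * snd z)))"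
        by (rule continuous_map_compose[OF _ H1(1)])
          (auto simp: II subtopology_subtopology intro!: continuous_intros)
      show "continuous_map (subtopology ?II {z \<in> topspace ?II. 1/2 \<le> snd z}) X
          (H2 \<circ> (\<lambda>z. (fst z, 2 * snd z - 1)))"
        by (rule continuous_map_compose[OF _ H2(1)])
          (auto simp: II subtopology_subtopology intro!: continuous_intros)
      show "(H1 \<circ> (\<lambda>z. (fst z, 2 * snd z))) z = (H2 \<circ> (\<lambda>z. (fst z, 2 * snd z - 1))) z"
        if "z \<in> topspace ?II" "snd z = 1/2" for z
      proof -
        have "z = (fst z, 1/2)" "fst z \<in> {0..1}" using that by (auto simp: II prod_eq_iff)
        then obtain t where "z = (t, 1/2)" "t \<in> {0..1}" by blast
        then show ?thesis using H1(4)[of t] H2(4)[of t] by simp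
      qed
    qed
    show "H (0, s) = concat_paths p q s" "H (1, s) = concat_paths p' q' s" for s
      using H1(2,3) H2(2,3) by (auto simp: H_def concat_paths_def)
    show "H (t, 0) = x" "H (t, 1) = x" if "t \<in> {0..1}" for t
      using H1(4)[OF that] H2(4)[OF that] by (auto simp: H_def)
  qed
qed

lemma concat_paths_loops:
  assumes "p \<in> loops X x" "q \<in> loops X x"
  shows "concat_paths p q \<in> loops X x"
proof -
  have "(p, p) \<in> loop_homotopic X x" "(q, q) \<in> loop_homotopic X x"
    using assms loop_class_eq_iff by metis+
  from loop_homotopic_concat[OF this] show ?thesis by (rule loop_homotopic_loops)
qed

lemma carrier_fundamental_group: "carrier (fundamental_group X x) = loop_class X x ` loops X x"
  by (auto simp: fundamental_group_def quotient_def loop_class_def)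

text \<open>Operations on classes are unions over representatives; they can be evaluated at any one of them.\<close>

lemma UN_loop_class_const:
  assumes "p \<in> loops X x" and "\<And>q. (p, q) \<in> loop_homotopic X x \<Longrightarrow> F q = F p"
  shows "(\<Union>q \<in> loop_class X x p. F q) = F p"
proof -
  have "(\<Union>q \<in> loop_class X x p. F q) = (\<Union>q \<in> loop_class X x p. F p)"
    by (intro SUP_cong refl assms(2) loop_classD)
  also have "\<dots> = F p" using loop_class_self[OF assms(1)] by blast
  finally show ?thesis .
qed

lemma mult_fundamental_group:
  assumes p: "p \<in> loops X x" and q: "q \<in> loops X x"
  shows "loop_class X x p \<otimes>\<^bsub>fundamental_group X x\<^esub> loop_class X x q = loop_class X x (concat_paths p q)"
proof -
  have eq: "loop_class X x (concat_paths p' q') = loop_class X x (concat_paths p q)"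
    if "(p, p') \<in> loop_homotopic X x" "(q, q') \<in> loop_homotopic X x" for p' q'
    using loop_homotopic_concat[OF that] loop_class_eq_iff loop_homotopic_loops by metis
  have rfl: "(p, p) \<in> loop_homotopic X x" "(q, q) \<in> loop_homotopic X x"
    using p q loop_class_eq_iff by metis+
  have inner: "(\<Union>q' \<in> loop_class X x q. loop_class X x (concat_paths p' q')) = loop_class X x (concat_paths p q)"
    if p': "(p, p') \<in> loop_homotopic X x" for p'
  proof -
    have "(\<Union>q' \<in> loop_class X x q. loop_class X x (concat_paths p' q')) = loop_class X x (concat_paths p' q)"
      by (rule UN_loop_class_const[OF q]) (simp only: eq[OF p'] rfl(2))
    then show ?thesis using eq[OF p' rfl(2)] by simp
  qed
  have "(\<Union>p' \<in> loop_class X x p. \<Union>q' \<in> loop_class X x q. loop_class X x (concat_paths p' q')) =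
      (\<Union>q' \<in> loop_class X x q. loop_class X x (concat_paths p q'))"
    by (rule UN_loop_class_const[OF p]) (simp only: inner rfl(1))
  then show ?thesis using inner[OF rfl(1)] by (simp add: fundamental_group_def)
qed

definition pi1_map :: "'b topology \<Rightarrow> 'b \<Rightarrow> ('a \<Rightarrow> 'b) \<Rightarrow> (real \<Rightarrow> 'a) set \<Rightarrow> (real \<Rightarrow> 'b) set" where
  "pi1_map Y y \<phi> P = (\<Union>p \<in> P. loop_class Y y (\<phi> \<circ> p))"

lemma comp_loops:
  assumes "continuous_map X Y \<phi>" "\<phi> x = y" "p \<in> loops X x"
  shows "\<phi> \<circ> p \<in> loops Y y"
  using assms by (auto simp: loops_def pathin_def intro: continuous_map_compose)

lemma pi1_map_loop_class:
  assumes \<phi>: "continuous_map X Y \<phi>" "\<phi> x = y" and p: "p \<in> loops X x"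
  shows "pi1_map Y y \<phi> (loop_class X x p) = loop_class Y y (\<phi> \<circ> p)"
  unfolding pi1_map_def
proof (rule UN_loop_class_const[OF p])
  fix q assume pq: "(p, q) \<in> loop_homotopic X x"
  then have q: "q \<in> loops X x" by (rule loop_homotopic_loops)
  have "homotopic_with (\<lambda>r. r 0 = y \<and> r 1 = y) (top_of_set {0..1}) Y (\<phi> \<circ> q) (\<phi> \<circ> p)"
    using pq by (intro homotopic_with_compose_continuous_map_left[OF _ \<phi>(1),
          where p = "\<lambda>r. r 0 = x \<and> r 1 = x"])
      (auto simp: loop_homotopic_def homotopic_with_sym \<phi>(2))
  from loop_homotopicI[OF this] show "loop_class Y y (\<phi> \<circ> q) = loop_class Y y (\<phi> \<circ> p)"
    using loop_class_eq_iff[OF comp_loops[OF \<phi> q] comp_loops[OF \<phi> p]] by blast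
qed

lemma pi1_map_hom:
  assumes \<phi>: "continuous_map X Y \<phi>" "\<phi> x = y"
  shows "pi1_map Y y \<phi> \<in> hom (fundamental_group X x) (fundamental_group Y y)"
proof (rule homI)
  fix P assume "P \<in> carrier (fundamental_group X x)"
  then show "pi1_map Y y \<phi> P \<in> carrier (fundamental_group Y y)"
    using pi1_map_loop_class[OF \<phi>] comp_loops[OF \<phi>] by (auto simp: carrier_fundamental_group)
next
  fix P Q assume "P \<in> carrier (fundamental_group X x)" "Q \<in> carrier (fundamental_group X x)"
  then obtain p q where p: "p \<in> loops X x" "P = loop_class X x p"
    and q: "q \<in> loops X x" "Q = loop_class X x q"
    by (auto simp: carrier_fundamental_group)
  have "\<phi> \<circ> concat_paths p q = concat_paths (\<phi> \<circ> p) (\<phi> \<circ> q)"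
    by (auto simp: concat_paths_def)
  then show "pi1_map Y y \<phi> (P \<otimes>\<^bsub>fundamental_group X x\<^esub> Q) =
      pi1_map Y y \<phi> P \<otimes>\<^bsub>fundamental_group Y y\<^esub> pi1_map Y y \<phi> Q"
    using p q by (simp add: mult_fundamental_group pi1_map_loop_class[OF \<phi>] comp_loops[OF \<phi>]
        concat_paths_loops)
qed

text \<open>A loop is a function on all of \<open>\<real>\<close>, but its class depends only on its values on the unit interval.
  This is needed because mutually inverse continuous maps cancel only on points of the space, which
  the values of a loop outside the unit interval need not be.\<close>

lemma loop_class_cong_unit_interval:
  assumes p: "p \<in> loops X x" and eq: "\<And>t. t \<in> {0..1} \<Longrightarrow> q t = p t"
  shows "loop_class X x q = loop_class X x p"
proof -
  have "(p, q) \<in> loop_homotopic X x"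
    using p eq by (intro loop_homotopicI homotopic_with_equal) (auto simp: loops_def pathin_def)
  then show ?thesis using loop_class_eq_iff loop_homotopic_loops by metis
qed

lemma pi1_map_inverse:
  assumes \<phi>: "continuous_map X Y \<phi>" "\<phi> x = y" and \<psi>: "continuous_map Y X \<psi>" "\<psi> y = x"
    and inv: "\<And>u. u \<in> topspace X \<Longrightarrow> \<psi> (\<phi> u) = u"
    and P: "P \<in> carrier (fundamental_group X x)"
  shows "pi1_map X x \<psi> (pi1_map Y y \<phi> P) = P"
proof -
  obtain p where p: "p \<in> loops X x" "P = loop_class X x p"
    using P by (auto simp: carrier_fundamental_group)
  have "p t \<in> topspace X" if "t \<in> {0..1}" for t
    using p(1) that path_image_subset_topspace[of X p] by (auto simp: loops_def)
  then have "loop_class X x (\<psi> \<circ> (\<phi> \<circ> p)) = loop_class X x p"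
    using inv by (intro loop_class_cong_unit_interval[OF p(1)]) simp
  then show ?thesis
    using p by (simp add: pi1_map_loop_class[OF \<phi>] pi1_map_loop_class[OF \<psi>] comp_loops[OF \<phi>])
qed

lemma pi1_map_iso:
  assumes \<phi>: "continuous_map X Y \<phi>" "\<phi> x = y" and \<psi>: "continuous_map Y X \<psi>" "\<psi> y = x"
    and inv: "\<And>u. u \<in> topspace X \<Longrightarrow> \<psi> (\<phi> u) = u" "\<And>v. v \<in> topspace Y \<Longrightarrow> \<phi> (\<psi> v) = v"
  shows "pi1_map Y y \<phi> \<in> iso (fundamental_group X x) (fundamental_group Y y)"
proof -
  note hom = pi1_map_hom[OF \<phi>] pi1_map_hom[OF \<psi>]
  have "bij_betw (pi1_map Y y \<phi>) (carrier (fundamental_group X x)) (carrier (fundamental_group Y y))"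
    by (rule bij_betw_byWitness[where f' = "pi1_map X x \<psi>"])
      (use hom pi1_map_inverse[OF \<phi> \<psi> inv(1)] pi1_map_inverse[OF \<psi> \<phi> inv(2)]
        in \<open>auto simp: hom_def\<close>)
  with hom(1) show ?thesis by (simp add: iso_def)
qed

section \<open>Restricting algebra endomorphisms\<close>

lemma alg_homD:
  assumes "h \<in> alg_hom K A B"
  shows "h \<in> ring_hom A B"
    and "x \<in> carrier A \<Longrightarrow> h x \<in> carrier B"
    and "r \<in> carrier K \<Longrightarrow> x \<in> carrier A \<Longrightarrow> h (r \<odot>\<^bsub>A\<^esub> x) = r \<odot>\<^bsub>B\<^esub> h x"
  using assms by (auto simp: alg_hom_def ring_hom_closed)

lemma id_alg_endo: "id \<in> alg_endo K A"
  by (auto simp: alg_hom_def ring_hom_def)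

lemma alg_hom_comp:
  "f \<in> alg_hom K A B \<Longrightarrow> g \<in> alg_hom K B C \<Longrightarrow> g \<circ> f \<in> alg_hom K A C"
  using ring_hom_trans[of f A B g C] by (auto simp: alg_hom_def ring_hom_closed)

text \<open>With \<open>u = f j\<close> this restricts \<open>f\<close> to an invariant subalgebra, and with \<open>u = id\<close> it inverts a
  bijective \<open>j\<close>.\<close>

lemma alg_hom_factor_through_injective:
  assumes D: "ring D" and smult: "\<And>r x. r \<in> carrier K \<Longrightarrow> x \<in> carrier D \<Longrightarrow> r \<odot>\<^bsub>D\<^esub> x \<in> carrier D"
    and C: "ring C" and smultC: "\<And>r x. r \<in> carrier K \<Longrightarrow> x \<in> carrier C \<Longrightarrow> r \<odot>\<^bsub>C\<^esub> x \<in> carrier C"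
    and j: "j \<in> alg_hom K D B" "inj_on j (carrier D)"
    and u: "u \<in> alg_hom K C B" "u ` carrier C \<subseteq> j ` carrier D"
  obtains g where "g \<in> alg_hom K C D" "\<And>x. x \<in> carrier C \<Longrightarrow> j (g x) = u x"
proof -
  interpret D: ring D by fact
  interpret C: ring C by fact
  define g where "g = (\<lambda>x. inv_into (carrier D) j (u x))"
  have g: "g x \<in> carrier D" "j (g x) = u x" if "x \<in> carrier C" for x
    using that u(2) by (auto simp: g_def f_inv_into_f inv_into_into image_subset_iff)
  have eqI: "a = b" if "j a = j b" "a \<in> carrier D" "b \<in> carrier D" for a b
    using inj_onD[OF j(2)] that by blast
  note jr = alg_homD(1)[OF j(1)] and ur = alg_homD(1)[OF u(1)]
  have "g \<in> alg_hom K C D"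
    unfolding alg_hom_def
  proof (intro CollectI conjI ballI ring_hom_memI)
    show "g x \<in> carrier D" if "x \<in> carrier C" for x using g that by blast
    show "g (x \<otimes>\<^bsub>C\<^esub> y) = g x \<otimes>\<^bsub>D\<^esub> g y" if "x \<in> carrier C" "y \<in> carrier C" for x y
      by (rule eqI) (use that in \<open>simp_all add: g ring_hom_mult[OF jr] ring_hom_mult[OF ur]\<close>)
    show "g (x \<oplus>\<^bsub>C\<^esub> y) = g x \<oplus>\<^bsub>D\<^esub> g y" if "x \<in> carrier C" "y \<in> carrier C" for x y
      by (rule eqI) (use that in \<open>simp_all add: g ring_hom_add[OF jr] ring_hom_add[OF ur]\<close>)
    show "g \<one>\<^bsub>C\<^esub> = \<one>\<^bsub>D\<^esub>"
      by (rule eqI) (simp_all add: g ring_hom_one[OF jr] ring_hom_one[OF ur])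
    show "g (r \<odot>\<^bsub>C\<^esub> x) = r \<odot>\<^bsub>D\<^esub> g x" if "r \<in> carrier K" "x \<in> carrier C" for r x
      by (rule eqI) (use that in \<open>simp_all add: g smult smultC alg_homD(3)[OF j(1)] alg_homD(3)[OF u(1)]\<close>)
  qed
  with g(2) that show thesis by blast
qed

text \<open>For mutually inverse \<open>i\<close> and \<open>j\<close>, the first restriction takes \<open>\<mu>\<^sub>f\<close> to \<open>\<mu>\<^sub>g\<close> with \<open>g = i f j\<close>, and \<open>f\<close>
  is the endomorphism that corresponds to \<open>g\<close> under \<open>i\<close>.\<close>

lemma spectral_restriction_inverse:
  assumes D: "pm_ring D" and B: "pm_ring B"
    and j: "j \<in> alg_hom K D B" "inj_on j (carrier D)" and i: "i \<in> alg_hom K B D" "inj_on i (carrier B)"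
    and ij: "\<And>x. x \<in> carrier D \<Longrightarrow> i (j x) = x" and ji: "\<And>y. y \<in> carrier B \<Longrightarrow> j (i y) = y"
    and u: "u \<in> topspace (spectral_space K B)"
  shows "spectral_restriction B D i (spectral_restriction D B j u) = u"
proof -
  obtain f where f: "f \<in> alg_endo K B" "u = spectral_map B f"
    using u by (auto simp: topspace_spectral_space[OF B])
  have g: "i \<circ> f \<circ> j \<in> alg_endo K D" using alg_hom_comp[OF alg_hom_comp[OF j(1) f(1)] i(1)]
    by (simp add: comp_assoc)
  note cl = alg_homD(2)[OF j(1)] alg_homD(2)[OF i(1)] alg_homD(2)[OF f(1)]
  have step: "spectral_restriction D B j u = spectral_map D (i \<circ> f \<circ> j)"
    unfolding f(2) by (rule spectral_restriction_spectral_map[OF D B alg_homD(1)[OF j(1)] j(2) f(1) g])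
      (simp add: ji cl)
  show ?thesis
    unfolding step unfolding f(2) by (rule spectral_restriction_spectral_map[OF B D alg_homD(1)[OF i(1)] i(2) g f(1)])
      (simp add: ji cl)
qed

section \<open>The quotient by the kernel\<close>

lemma cring_quot_algebra:
  assumes "cring A" "ideal I A"
  shows "cring (quot_algebra A I)"
proof -
  interpret Q: cring "A Quot I" using ideal.quotient_is_cring[OF assms(2,1)] .
  show ?thesis
  proof (rule cringI)
    show "abelian_group (quot_algebra A I)"
    proof (rule abelian_groupI)
      show "\<exists>y\<in>carrier (quot_algebra A I). y \<oplus>\<^bsub>quot_algebra A I\<^esub> x = \<zero>\<^bsub>quot_algebra A I\<^esub>"
        if "x \<in> carrier (quot_algebra A I)" for x
        using that Q.l_neg[of x] Q.a_inv_closed[of x]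
        by (intro bexI[of _ "\<ominus>\<^bsub>A Quot I\<^esub> x"]) (simp_all add: quot_algebra_def)
    qed (simp_all add: quot_algebra_def Q.a_ac)
    show "comm_monoid (quot_algebra A I)"
      by (rule comm_monoidI) (simp_all add: quot_algebra_def Q.m_ac)
    show "(x \<oplus>\<^bsub>quot_algebra A I\<^esub> y) \<otimes>\<^bsub>quot_algebra A I\<^esub> z =
        x \<otimes>\<^bsub>quot_algebra A I\<^esub> z \<oplus>\<^bsub>quot_algebra A I\<^esub> y \<otimes>\<^bsub>quot_algebra A I\<^esub> z"
      if "x \<in> carrier (quot_algebra A I)" "y \<in> carrier (quot_algebra A I)"
        "z \<in> carrier (quot_algebra A I)" for x y z
      using that by (simp add: quot_algebra_def Q.l_distr)
  qed
qed

lemma carrier_quot_algebra: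
  "carrier (quot_algebra A I) = (\<lambda>a. I +>\<^bsub>A\<^esub> a) ` carrier A"
  by (auto simp: quot_algebra_def FactRing_def A_RCOSETS_def')

lemma rcos_ring_hom_quot_algebra:
  assumes "ideal I A"
  shows "(\<lambda>a. I +>\<^bsub>A\<^esub> a) \<in> ring_hom A (quot_algebra A I)"
  using ideal.rcos_ring_hom[OF assms] by (simp add: ring_hom_def quot_algebra_def)

lemma pm_ring_quot_algebra:
  assumes "pm_ring A" "ideal I A"
  shows "pm_ring (quot_algebra A I)"
  using assms(1) cring_quot_algebra[OF _ assms(2)] rcos_ring_hom_quot_algebra[OF assms(2)]
    carrier_quot_algebra[symmetric]
  by (rule pm_ring_hom_image) (use assms(1) in \<open>auto simp: pm_ring_def\<close>)

lemma smult_quot_algebra_closed: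
  assumes "algebra K A" "ideal I A" "r \<in> carrier K" "X \<in> carrier (quot_algebra A I)"
  shows "r \<odot>\<^bsub>quot_algebra A I\<^esub> X \<in> carrier (quot_algebra A I)"
proof -
  interpret algebra K A by fact
  show ?thesis
    using assms(3,4) quot_algebra_smult[OF assms(1-3)] by (auto simp: carrier_quot_algebra)
qed

lemma factor_map_alg_hom:
  assumes A: "algebra K A" and B: "algebra K B" and h: "h \<in> alg_hom K A B"
  defines "I \<equiv> a_kernel A B h"
  shows "ideal I A"
    and "factor_map h \<in> alg_hom K (quot_algebra A I) B"
    and "inj_on (factor_map h) (carrier (quot_algebra A I))"
    and "factor_map h ` carrier (quot_algebra A I) = h ` carrier A"
proof -
  interpret A: algebra K A by fact
  interpret B: algebra K B by fact
  interpret h: ring_hom_ring A B h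
    using alg_homD(1)[OF h] A.ring_axioms B.ring_axioms by (intro ring_hom_ringI2)
  show I: "ideal I A" unfolding I_def by (rule h.kernel_is_ideal)
  have fm: "factor_map h = (\<lambda>X. the_elem (h ` X))" by (simp add: factor_map_def fun_eq_iff)
  have fh: "factor_map h (I +>\<^bsub>A\<^esub> a) = h a" if "a \<in> carrier A" for a
    using h.the_elem_simp[OF that] by (simp add: fm I_def)
  have "factor_map h \<in> ring_hom (quot_algebra A I) B"
    using h.the_elem_hom by (simp add: fm I_def ring_hom_def quot_algebra_def)
  moreover have "factor_map h (r \<odot>\<^bsub>quot_algebra A I\<^esub> X) = r \<odot>\<^bsub>B\<^esub> factor_map h X"
    if "r \<in> carrier K" "X \<in> carrier (quot_algebra A I)" for r X
    using that quot_algebra_smult[OF A I that(1)] alg_homD(3)[OF h that(1)]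
    by (auto simp: carrier_quot_algebra fh)
  ultimately show "factor_map h \<in> alg_hom K (quot_algebra A I) B" by (simp add: alg_hom_def)
  show "inj_on (factor_map h) (carrier (quot_algebra A I))"
    using h.the_elem_inj by (auto simp: inj_on_def fm I_def quot_algebra_def)
  show "factor_map h ` carrier (quot_algebra A I) = h ` carrier A"
    unfolding carrier_quot_algebra image_image using fh by simp
qed

theorem theorem4p2:
  fixes k :: "real set"
    and A :: "(real, 'a) module" and B :: "(real, 'b) module"
    and h :: "'a \<Rightarrow> 'b" and I :: "'a set"
  defines "K \<equiv> real_subring k"
    and "Q \<equiv> quot_algebra A I"
  assumes "k = \<int> \<or> k = UNIV"
    and "pm_ring A" and "algebra K A"
    and "pm_ring B" and "algebra K B"
    and "h \<in> alg_hom K A B"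
    and "I = a_kernel A B h"
    and "fully_invariant K B (h ` carrier A)"
  shows "\<exists>\<phi> hs.
      continuous_map (spectral_space K B) (spectral_space K Q) \<phi> \<and>
      (\<forall>f \<in> alg_endo K B. \<exists>g \<in> alg_endo K Q.
         (\<forall>X \<in> carrier Q. factor_map h (g X) = f (factor_map h X)) \<and>
         \<phi> (spectral_map B f) = spectral_map Q g) \<and>
      (\<forall>\<gamma> \<in> loops (spectral_space K B) (spectral_map B id).
         hs (loop_class (spectral_space K B) (spectral_map B id) \<gamma>) =
         loop_class (spectral_space K Q) (spectral_map Q id) (\<phi> \<circ> \<gamma>)) \<and>
      hs \<in> hom (pi_alg K B) (pi_alg K Q) \<and>
      (h \<in> alg_iso K A B \<longrightarrow> hs \<in> iso (pi_alg K B) (pi_alg K Q))"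
proof -
  note B = \<open>pm_ring B\<close> and algA = \<open>algebra K A\<close> and algB = \<open>algebra K B\<close>
  define j where "j = factor_map h"
  note facts = factor_map_alg_hom[OF algA algB \<open>h \<in> alg_hom K A B\<close>,
      folded \<open>I = a_kernel A B h\<close> Q_def j_def]
  note j = facts(2,3)
  have Q: "pm_ring Q" unfolding Q_def by (rule pm_ring_quot_algebra[OF \<open>pm_ring A\<close> facts(1)])
  have rings: "ring Q" "ring B" using Q B by (auto simp: pm_ring_def cring_def)
  have smult: "r \<odot>\<^bsub>Q\<^esub> X \<in> carrier Q" if "r \<in> carrier K" "X \<in> carrier Q" for r X
    using smult_quot_algebra_closed[OF algA facts(1)] that by (simp add: Q_def)
  have smultB: "r \<odot>\<^bsub>B\<^esub> x \<in> carrier B" if "r \<in> carrier K" "x \<in> carrier B" for r x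
    using algB that by (auto simp: algebra_def intro: module.smult_closed)
  have restrict: "\<exists>g \<in> alg_endo K Q. \<forall>X \<in> carrier Q. j (g X) = f (j X)" if f: "f \<in> alg_endo K B" for f
  proof -
    have "(f \<circ> j) ` carrier Q \<subseteq> j ` carrier Q"
      using \<open>fully_invariant K B (h ` carrier A)\<close> f
      unfolding fully_invariant_def image_comp[symmetric] facts(4) by blast
    then show ?thesis
      using alg_hom_factor_through_injective[OF rings(1) smult rings(1) smult j alg_hom_comp[OF j(1) f]]
      by (metis comp_apply)
  qed
  define \<phi> where "\<phi> = spectral_restriction Q B j"
  have \<phi>: "continuous_map (spectral_space K B) (spectral_space K Q) \<phi>"
    unfolding \<phi>_def using restrict by (intro continuous_map_spectral_restriction[OF Q B alg_homD(1)[OF j(1)] j(2)])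
  have \<phi>_map: "\<phi> (spectral_map B f) = spectral_map Q g"
    if "f \<in> alg_endo K B" "g \<in> alg_endo K Q" "\<And>X. X \<in> carrier Q \<Longrightarrow> j (g X) = f (j X)" for f g
    unfolding \<phi>_def by (rule spectral_restriction_spectral_map[OF Q B alg_homD(1)[OF j(1)] j(2) that])
  have base: "\<phi> (spectral_map B id) = spectral_map Q id"
    by (rule \<phi>_map[OF id_alg_endo id_alg_endo]) simp
  define hs where "hs = pi1_map (spectral_space K Q) (spectral_map Q id) \<phi>"
  have iso: "hs \<in> iso (pi_alg K B) (pi_alg K Q)" if h_iso: "h \<in> alg_iso K A B"
  proof -
    have im: "j ` carrier Q = carrier B"
      using h_iso facts(4) by (auto simp: alg_iso_def bij_betw_def)
    have id_im: "id ` carrier B \<subseteq> j ` carrier Q" by (simp add: im)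
    obtain i where i: "i \<in> alg_hom K B Q" "\<And>y. y \<in> carrier B \<Longrightarrow> j (i y) = y"
      using alg_hom_factor_through_injective[OF rings(1) smult rings(2) smultB j id_alg_endo id_im]
      by (metis id_apply)
    have ij: "i (j X) = X" if "X \<in> carrier Q" for X
      using inj_onD[OF j(2), of "i (j X)" X] i(2) alg_homD(2)[OF i(1)] alg_homD(2)[OF j(1)] that by simp
    have inj: "inj_on i (carrier B)" using i(2) by (rule inj_on_inverseI)
    define \<psi> where "\<psi> = spectral_restriction B Q i"
    have lift: "\<exists>f \<in> alg_endo K B. \<forall>y \<in> carrier B. i (f y) = g (i y)" if g: "g \<in> alg_endo K Q" for g
      using alg_hom_comp[OF alg_hom_comp[OF i(1) g] j(1)] ij alg_homD(2)[OF g] alg_homD(2)[OF i(1)]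
      by (intro bexI[of _ "j \<circ> (g \<circ> i)"]) simp_all
    have \<psi>: "continuous_map (spectral_space K Q) (spectral_space K B) \<psi>"
      unfolding \<psi>_def using lift by (intro continuous_map_spectral_restriction[OF B Q alg_homD(1)[OF i(1)] inj])
    have "\<psi> (spectral_map Q id) = spectral_map B id"
      unfolding \<psi>_def
      by (rule spectral_restriction_spectral_map[OF B Q alg_homD(1)[OF i(1)] inj id_alg_endo[where K=K] id_alg_endo]) simp
    moreover have "\<psi> (\<phi> u) = u" if "u \<in> topspace (spectral_space K B)" for u
      unfolding \<phi>_def \<psi>_def by (rule spectral_restriction_inverse[OF Q B j i(1) inj ij i(2) that])
    moreover have "\<phi> (\<psi> v) = v" if "v \<in> topspace (spectral_space K Q)" for v
      unfolding \<phi>_def \<psi>_def by (rule spectral_restriction_inverse[OF B Q i(1) inj j i(2) ij that])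
    ultimately show ?thesis
      unfolding hs_def pi_alg_def by (intro pi1_map_iso[OF \<phi> base \<psi>])
  qed
  show ?thesis
  proof (intro exI conjI ballI impI)
    show "continuous_map (spectral_space K B) (spectral_space K Q) \<phi>" by fact
    show "\<exists>g \<in> alg_endo K Q. (\<forall>X \<in> carrier Q. factor_map h (g X) = f (factor_map h X)) \<and>
        \<phi> (spectral_map B f) = spectral_map Q g" if "f \<in> alg_endo K B" for f
      using restrict[OF that] \<phi>_map[OF that] unfolding j_def by blast
    show "hs (loop_class (spectral_space K B) (spectral_map B id) \<gamma>) =
        loop_class (spectral_space K Q) (spectral_map Q id) (\<phi> \<circ> \<gamma>)"
      if "\<gamma> \<in> loops (spectral_space K B) (spectral_map B id)" for \<gamma>
      unfolding hs_def by (rule pi1_map_loop_class[OF \<phi> base that])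
    show "hs \<in> hom (pi_alg K B) (pi_alg K Q)"
      unfolding hs_def pi_alg_def by (rule pi1_map_hom[OF \<phi>]) (rule base)
    show "hs \<in> iso (pi_alg K B) (pi_alg K Q)" if "h \<in> alg_iso K A B" using iso[OF that] .
  qed
qed

end
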